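(* Let $\Gamma$ be a hyperbolic group. Then there exists $p$ with $2\leq p<\infty$ such that $\Gamma$ admits a proper affine isometric action on an $l^p$-space.
   Context: Hyperbolic groups: Let $\Gamma$ be a finitely generated group with finite generating set $S$. The Cayley graph $G$ of $\Gamma$ with respect to $S$ has vertex set $G^{(0)}=\Gamma$ and edge set $\Gamma\times S$, where the edge $(g,s)$ spans the vertices $g$ and $gs$. $G$ carries the path metric $d$ obtained by assigning length $1$ to each edge. The group $\Gamma$ is called hyperbolic if there is a constant $\delta\geq 0$ such that all geodesic triangles in $G$ are $\delta$-fine in the following sense: if $a,b,c$ are vertices of $G$, $[a,b]$, $[b,c]$, $[c,a]$ are geodesics from $a$ to $b$, from $b$ to $c$, and from $c$ to $a$ respectively, and points $\bar a\in[b,c]$, $v,\bar c\in[a,b]$, $w,\bar b\in[a,c]$ satisfy $d(b,\bar c)=d(b,\bar a)$, $d(c,\bar a)=d(c,\bar b)$, $d(a,v)=d(a,w)\leq d(a,\bar c)=d(a,\bar b)$, then $d(v,w)\leq\delta$. This notion does not depend on the choice of the finite generating set $S$. Proper affine isometric actions: An affine isometric action $\alpha$ of a countable discrete group $\Gamma$ on a Banach space $X$ is an action of the form $\alpha(g)\xi=\pi(g)\xi+b(g)$ ($g\in\Gamma$, $\xi\in X$), where $\pi$ is an action of $\Gamma$ on $X$ by linear isometries and $b:\Gamma\to X$ is a map. It is called proper if $\lim_{g\to\infty}\|\alpha(g)\xi\|=\infty$ for every $\xi\in X$, where $g\to\infty$ means that $g$ leaves every finite subset of $\Gamma$. An $l^p$-space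 is the Banach space $l^p(I)$ of $p$-summable functions on a discrete set $I$. *)

theory Defs
  imports "HOL-Analysis.Analysis" "HOL-Algebra.Generated_Groups" "HOL-Algebra.Group_Action"
begin

(* The Cayley graph is the geometric graph, not only its vertex set.  Inner g s t is the point
   at distance t from g in the interior of the edge (g, s); edge_point parametrises the
   closed edge by [0, 1] and takes care of the identification of end points. *)

datatype 'a cayley_point = Vertex 'a | Inner 'a 'a real

definition edge_point :: "('a, 'm) monoid_scheme \<Rightarrow> 'a \<Rightarrow> 'a \<Rightarrow> real \<Rightarrow> 'a cayley_point" where
  "edge_point G g s t =
     (if t = 0 then Vertex g else if t = 1 then Vertex (g \<otimes>\<^bsub>G\<^esub> s) else Inner g s t)"

definition cayley_graph :: "('a, 'm) monoid_scheme \<Rightarrow> 'a set \<Rightarrow> 'a cayley_point set" where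
  "cayley_graph G S =
     Vertex ` carrier G \<union> {edge_point G g s t | g s t. g \<in> carrier G \<and> s \<in> S \<and> t \<in> {0..1}}"

(* cayley_path G S x l y: there is a piecewise linear path of length l from x to y.
   Each piece runs inside one closed edge, in either direction. *)

inductive cayley_path ::
    "('a, 'm) monoid_scheme \<Rightarrow> 'a set \<Rightarrow> 'a cayley_point \<Rightarrow> real \<Rightarrow> 'a cayley_point \<Rightarrow> bool"
  for G S where
  trivial: "x \<in> cayley_graph G S \<Longrightarrow> cayley_path G S x 0 x"
| segment: "\<lbrakk>cayley_path G S x l (edge_point G g s t); g \<in> carrier G; s \<in> S;
             t \<in> {0..1}; u \<in> {0..1}\<rbrakk>
            \<Longrightarrow> cayley_path G S x (l + \<bar>t - u\<bar>) (edge_point G g s u)"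

definition cayley_dist ::
    "('a, 'm) monoid_scheme \<Rightarrow> 'a set \<Rightarrow> 'a cayley_point \<Rightarrow> 'a cayley_point \<Rightarrow> real" where
  "cayley_dist G S x y = Inf {l. cayley_path G S x l y}"

definition geodesic_segment ::
    "('a, 'm) monoid_scheme \<Rightarrow> 'a set \<Rightarrow> 'a cayley_point \<Rightarrow> 'a cayley_point
      \<Rightarrow> 'a cayley_point set \<Rightarrow> bool" where
  "geodesic_segment G S x y P \<longleftrightarrow>
     (\<exists>L \<gamma>. 0 \<le> L \<and> \<gamma> ` {0..L} \<subseteq> cayley_graph G S \<and> \<gamma> 0 = x \<and> \<gamma> L = y \<and>
        (\<forall>s\<in>{0..L}. \<forall>t\<in>{0..L}. cayley_dist G S (\<gamma> s) (\<gamma> t) = \<bar>s - t\<bar>) \<and>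
        P = \<gamma> ` {0..L})"

definition fine_triangles :: "('a, 'm) monoid_scheme \<Rightarrow> 'a set \<Rightarrow> real \<Rightarrow> bool" where
  "fine_triangles G S \<delta> \<longleftrightarrow>
     (\<forall>a\<in>carrier G. \<forall>b\<in>carrier G. \<forall>c\<in>carrier G. \<forall>ab bc ca.
        geodesic_segment G S (Vertex a) (Vertex b) ab \<longrightarrow>
        geodesic_segment G S (Vertex b) (Vertex c) bc \<longrightarrow>
        geodesic_segment G S (Vertex c) (Vertex a) ca \<longrightarrow>
        (\<forall>a'\<in>bc. \<forall>v\<in>ab. \<forall>c'\<in>ab. \<forall>w\<in>ca. \<forall>b'\<in>ca.
           cayley_dist G S (Vertex b) c' = cayley_dist G S (Vertex b) a' \<and>
           cayley_dist G S (Vertex c) a' = cayley_dist G S (Vertex c) b' \<and>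
           cayley_dist G S (Vertex a) v = cayley_dist G S (Vertex a) w \<and>
           cayley_dist G S (Vertex a) w \<le> cayley_dist G S (Vertex a) c' \<and>
           cayley_dist G S (Vertex a) c' = cayley_dist G S (Vertex a) b' \<longrightarrow>
           cayley_dist G S v w \<le> \<delta>))"

definition hyperbolic_group :: "('a, 'm) monoid_scheme \<Rightarrow> bool" where
  "hyperbolic_group G \<longleftrightarrow>
     group G \<and>
     (\<exists>S. finite S \<and> S \<subseteq> carrier G \<and> generate G S = carrier G \<and>
        (\<exists>\<delta>\<ge>0. fine_triangles G S \<delta>))"

(* l^p(I) consists of functions on the whole index type that vanish outside I. *)

definition lp_space :: "real \<Rightarrow> 'i set \<Rightarrow> ('i \<Rightarrow> 'k::real_normed_field) set" where
  "lp_space p I =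
     {f. (\<forall>i. i \<notin> I \<longrightarrow> f i = 0) \<and> (\<lambda>i. norm (f i) powr p) summable_on I}"

definition lp_norm :: "real \<Rightarrow> 'i set \<Rightarrow> ('i \<Rightarrow> 'k::real_normed_field) \<Rightarrow> real" where
  "lp_norm p I f = (\<Sum>\<^sub>\<infinity>i\<in>I. norm (f i) powr p) powr (1 / p)"

(* In the next two definitions (X, N) is a normed space whose elements are 'k-valued
   functions with pointwise vector space operations. *)

definition linear_isometric_action ::
    "('a, 'm) monoid_scheme \<Rightarrow> ('i \<Rightarrow> 'k::real_normed_field) set \<Rightarrow> (('i \<Rightarrow> 'k) \<Rightarrow> real)
      \<Rightarrow> ('a \<Rightarrow> ('i \<Rightarrow> 'k) \<Rightarrow> ('i \<Rightarrow> 'k)) \<Rightarrow> bool" where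
  "linear_isometric_action G X N \<pi> \<longleftrightarrow>
     group_action G X \<pi> \<and>
     (\<forall>g\<in>carrier G.
        (\<forall>\<xi>\<in>X. \<forall>\<eta>\<in>X. \<pi> g (\<lambda>i. \<xi> i + \<eta> i) = (\<lambda>i. \<pi> g \<xi> i + \<pi> g \<eta> i)) \<and>
        (\<forall>c. \<forall>\<xi>\<in>X. \<pi> g (\<lambda>i. c * \<xi> i) = (\<lambda>i. c * \<pi> g \<xi> i)) \<and>
        (\<forall>\<xi>\<in>X. N (\<pi> g \<xi>) = N \<xi>))"

definition affine_isometric_action ::
    "('a, 'm) monoid_scheme \<Rightarrow> ('i \<Rightarrow> 'k::real_normed_field) set \<Rightarrow> (('i \<Rightarrow> 'k) \<Rightarrow> real)
      \<Rightarrow> ('a \<Rightarrow> ('i \<Rightarrow> 'k) \<Rightarrow> ('i \<Rightarrow> 'k)) \<Rightarrow> bool" where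
  "affine_isometric_action G X N \<alpha> \<longleftrightarrow>
     group_action G X \<alpha> \<and>
     (\<exists>\<pi> b. linear_isometric_action G X N \<pi> \<and> b \<in> carrier G \<rightarrow> X \<and>
        (\<forall>g\<in>carrier G. \<forall>\<xi>\<in>X. \<alpha> g \<xi> = (\<lambda>i. \<pi> g \<xi> i + b g i)))"

(* The filter is generated by the complements in carrier G of its finite subsets; it is trivial
   for finite G, whose actions are thus all proper. *)

definition proper_action ::
    "('a, 'm) monoid_scheme \<Rightarrow> 'v set \<Rightarrow> ('v \<Rightarrow> real) \<Rightarrow> ('a \<Rightarrow> 'v \<Rightarrow> 'v) \<Rightarrow> bool" where
  "proper_action G X N \<alpha> \<longleftrightarrow>
     (\<forall>\<xi>\<in>X. filterlim (\<lambda>g. N (\<alpha> g \<xi>)) at_top (inf cofinite (principal (carrier G))))"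

(* The index set I ranges over subsets of nat.  This costs nothing for a countable group: the
   action exists on some l^p(I) iff it exists on one with I countable.
   A complete real normed field 'k is, up to isometric isomorphism, the reals or the complex
   numbers, so 'k covers real and complex scalars at once. *)

definition admits_proper_affine_lp_action ::
    "('a, 'm) monoid_scheme \<Rightarrow> real \<Rightarrow> 'k::{real_normed_field,banach} itself \<Rightarrow> bool" where
  "admits_proper_affine_lp_action G p _ \<longleftrightarrow>
     (\<exists>(I :: nat set) (\<alpha> :: 'a \<Rightarrow> (nat \<Rightarrow> 'k) \<Rightarrow> (nat \<Rightarrow> 'k)).
        affine_isometric_action G (lp_space p I) (lp_norm p I) \<alpha> \<and>
        proper_action G (lp_space p I) (lp_norm p I) \<alpha>)"

end

theory Submission
  imports Defs
begin

text \<open>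
  Let \<open>d\<close> be the word metric of a hyperbolic group \<open>G\<close>.  Every vertex \<open>x\<close> of the Cayley graph
  looks at the group through a random descent: from \<open>y\<close>, jump to a random vertex that is closer
  to \<open>x\<close> and lies near a geodesic from \<open>y\<close> to \<open>x\<close>, always landing on a sphere around \<open>x\<close> whose
  radius is a multiple of a fixed number \<open>k\<close>, and stop at distance at most \<open>k\<close> from \<open>x\<close>.  Let
  \<open>hitting x z y\<close> be the probability that this descent stops in \<open>z\<close>.  The construction uses
  only the metric, so \<open>hitting (g x) (g z) (g y) = hitting x z y\<close>, and the functions
  \<open>b g (x, z) = hitting x z g - hitting x z 1\<close> form a cocycle for the permutation representation
  of \<open>G\<close> on functions on \<open>G \<times> G\<close>.  It remains to see that \<open>b g\<close> is \<open>p\<close>-summable for some \<open>p\<close> and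
  that its norm tends to infinity.

  Summability.  Descents towards \<open>x\<close> from two adjacent vertices stay within a bounded distance
  of each other, because in a hyperbolic graph the targets of a jump depend on the starting point
  only up to a bounded error (\<open>shadows_meet\<close>).  The sets of targets also overlap and have bounded
  cardinality, so at each jump the two descents merge with a definite probability
  (\<open>mean_coupling\<close>).  Hence the hitting probabilities seen from \<open>a\<close> and from an adjacent \<open>a'\<close>
  differ by at most a constant times \<open>\<lambda> ^ d x a\<close> for some \<open>\<lambda> < 1\<close> (\<open>hitting_adjacent\<close>).  Spheres
  grow at most exponentially and the descent stops at one of boundedly many \<open>z\<close>, so the \<open>p\<close>-th
  powers are summable over \<open>(x, z)\<close> once \<open>p\<close> is large (\<open>exists_summable_exponent\<close>); along a path
  from \<open>1\<close> to \<open>g\<close> this extends to all \<open>b g\<close>.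

  Properness.  If \<open>x\<close> lies on a geodesic from \<open>1\<close> to \<open>g\<close>, away from the ends, then the descents
  from \<open>1\<close> and \<open>g\<close> approach \<open>x\<close> along the two halves of the geodesic and stop in disjoint sets of
  bounded size.  So some \<open>z\<close> has \<open>\<bar>b g (x, z)\<bar>\<close> bounded below (\<open>hitting_separates\<close>), and
  the \<open>p\<close>-th power of the norm of \<open>b g\<close> grows at least linearly in \<open>d 1 g\<close>.

  The only information about the geometric Cayley graph that enters is the following consequence
  of fine triangles (\<open>thin_from_fine_triangles\<close>): vertices on two geodesics from \<open>x\<close> to \<open>y\<close> and
  \<open>y'\<close>, at the same distance from \<open>x\<close> not exceeding the Gromov product of \<open>y\<close> and \<open>y'\<close>, are
  uniformly close.
\<close>

section \<open>The word metric of a finitely generated group\<close>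

locale finitely_generated_group = group G for G (structure) +
  fixes S :: "'a set"
  assumes finite_generators: "finite S"
    and generators_subset: "S \<subseteq> carrier G"
    and generates: "generate G S = carrier G"
begin

definition adjacent :: "('a \<times> 'a) set" where
  "adjacent = {(g, h). g \<in> carrier G \<and> h \<in> carrier G \<and> (\<exists>s\<in>S. h = g \<otimes> s \<or> g = h \<otimes> s)}"

definition word_dist :: "'a \<Rightarrow> 'a \<Rightarrow> nat" where
  "word_dist g h = (LEAST n. (g, h) \<in> adjacent ^^ n)"

lemma adjacent_power_sym: "(g, h) \<in> adjacent ^^ n \<Longrightarrow> (h, g) \<in> adjacent ^^ n"
proof (induction n arbitrary: g h)
  case (Suc n)
  then obtain k where k: "(g, k) \<in> adjacent ^^ n" "(k, h) \<in> adjacent" by auto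
  from k(2) have "(h, k) \<in> adjacent" by (auto simp: adjacent_def)
  with Suc.IH[OF k(1)] show ?case by (meson relpow_Suc_I2)
qed simp

lemma adjacent_power_carrier:
  "(g, h) \<in> adjacent ^^ n \<Longrightarrow> g \<in> carrier G \<Longrightarrow> h \<in> carrier G"
  by (cases n) (auto simp: adjacent_def)

lemma connected:
  assumes "g \<in> carrier G" "h \<in> carrier G"
  shows "(g, h) \<in> adjacent\<^sup>*"
proof -
  have "\<forall>g\<in>carrier G. (g, g \<otimes> x) \<in> adjacent\<^sup>*" if "x \<in> generate G S" for x
    using that
  proof induction
    case one
    then show ?case by simp
  next
    case (incl h)
    then have "(g, g \<otimes> h) \<in> adjacent" if "g \<in> carrier G" for g
      using that generators_subset by (auto simp: adjacent_def)
    then show ?case by blast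
  next
    case (inv h)
    then have "h \<in> carrier G" using generators_subset by auto
    then have "(g, g \<otimes> inv h) \<in> adjacent" if "g \<in> carrier G" for g
      using that inv by (auto simp: adjacent_def m_assoc intro!: bexI[of _ h])
    then show ?case by blast
  next
    case (eng h1 h2)
    then have "h1 \<in> carrier G" "h2 \<in> carrier G" using generates by auto
    then have "(g \<otimes> h1, g \<otimes> (h1 \<otimes> h2)) \<in> adjacent\<^sup>*" if "g \<in> carrier G" for g
      using eng.IH(2)[rule_format, of "g \<otimes> h1"] that by (simp add: m_assoc)
    with eng.IH(1) show ?case by (meson rtrancl_trans)
  qed
  moreover have "inv g \<otimes> h \<in> generate G S" using assms generates by simp
  moreover have "g \<otimes> (inv g \<otimes> h) = h" using assms by (simp add: m_assoc[symmetric])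
  ultimately show ?thesis using assms(1) by metis
qed

lemma word_dist_path:
  assumes "g \<in> carrier G" "h \<in> carrier G"
  shows "(g, h) \<in> adjacent ^^ word_dist g h"
  unfolding word_dist_def
  using LeastI_ex[OF rtrancl_imp_relpow[OF connected[OF assms]]] .

lemma word_dist_le: "(g, h) \<in> adjacent ^^ n \<Longrightarrow> word_dist g h \<le> n"
  unfolding word_dist_def by (rule Least_le)

lemma word_dist_commute:
  assumes "g \<in> carrier G" "h \<in> carrier G"
  shows "word_dist g h = word_dist h g"
  by (rule antisym; rule word_dist_le; rule adjacent_power_sym; rule word_dist_path; fact assms)

lemma word_dist_triangle:
  assumes "g \<in> carrier G" "h \<in> carrier G" "k \<in> carrier G"
  shows "word_dist g k \<le> word_dist g h + word_dist h k"
proof (rule word_dist_le)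
  show "(g, k) \<in> adjacent ^^ (word_dist g h + word_dist h k)"
    unfolding relpow_add using assms by (blast intro: relcompI word_dist_path)
qed

lemma word_dist_self [simp]: "word_dist g g = 0"
  using word_dist_le[of g g 0] by simp

lemma word_dist_eq_0_iff:
  assumes "g \<in> carrier G" "h \<in> carrier G"
  shows "word_dist g h = 0 \<longleftrightarrow> g = h"
  using word_dist_path[OF assms] word_dist_self by (metis relpow_0_E)

lemma word_dist_intermediate:
  assumes "g \<in> carrier G" "h \<in> carrier G" "n \<le> word_dist g h"
  shows "\<exists>k\<in>carrier G. word_dist g k = n \<and> word_dist k h = word_dist g h - n"
proof -
  let ?m = "word_dist g h - n"
  have "(g, h) \<in> adjacent ^^ (n + ?m)"
    using word_dist_path[OF assms(1,2)] assms(3) by simp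
  then obtain k where k: "(g, k) \<in> adjacent ^^ n" "(k, h) \<in> adjacent ^^ ?m"
    unfolding relpow_add by auto
  have kc: "k \<in> carrier G" using adjacent_power_carrier k(1) assms(1) by blast
  have "word_dist g k = n \<and> word_dist k h = ?m"
    using word_dist_le[OF k(1)] word_dist_le[OF k(2)] word_dist_triangle[OF assms(1) kc assms(2)]
      assms(3) by linarith
  with kc show ?thesis by blast
qed

lemma word_dist_adjacent:
  assumes "g \<in> carrier G" "h \<in> carrier G" "word_dist g h = 1"
  shows "(g, h) \<in> adjacent"
  using word_dist_path[OF assms(1,2)] assms(3) by simp

lemma unit_sphere_bound:
  assumes "g \<in> carrier G"
  shows "finite {h \<in> carrier G. word_dist g h = 1}"
    and "card {h \<in> carrier G. word_dist g h = 1} \<le> 2 * card S"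
proof -
  let ?A = "{h \<in> carrier G. word_dist g h = 1}"
    and ?B = "(\<lambda>s. g \<otimes> s) ` S \<union> (\<lambda>s. g \<otimes> inv s) ` S"
  have fin: "finite ?B" using finite_generators by simp
  have sub: "?A \<subseteq> ?B"
  proof
    fix h assume h: "h \<in> ?A"
    then have "(g, h) \<in> adjacent" using assms word_dist_adjacent by auto
    then obtain s where s: "s \<in> S" "h = g \<otimes> s \<or> g = h \<otimes> s" by (auto simp: adjacent_def)
    with h generators_subset have "h = g \<otimes> s \<or> h = g \<otimes> inv s"
      by (auto simp: m_assoc subsetD)
    with s(1) show "h \<in> ?B" by blast
  qed
  have "card ?B \<le> card S + card S"
    by (intro order.trans[OF card_Un_le] add_mono card_image_le finite_generators)
  then show "card ?A \<le> 2 * card S" using card_mono[OF fin sub] by linarith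
  show "finite ?A" using fin sub by (rule finite_subset[rotated])
qed

lemma adjacent_power_translate:
  assumes "x \<in> carrier G" "(g, h) \<in> adjacent ^^ n"
  shows "(x \<otimes> g, x \<otimes> h) \<in> adjacent ^^ n"
  using assms(2)
proof (induction n arbitrary: h)
  case (Suc n)
  then obtain k where k: "(g, k) \<in> adjacent ^^ n" "(k, h) \<in> adjacent" by auto
  from k(2) have "(x \<otimes> k, x \<otimes> h) \<in> adjacent"
    using assms(1) generators_subset by (auto simp: adjacent_def m_assoc subsetD)
  with Suc.IH[OF k(1)] show ?case by auto
qed simp

lemma word_dist_translate:
  assumes "x \<in> carrier G" "g \<in> carrier G" "h \<in> carrier G"
  shows "word_dist (x \<otimes> g) (x \<otimes> h) = word_dist g h"
proof (rule antisym)
  have le: "word_dist (y \<otimes> a) (y \<otimes> b) \<le> word_dist a b"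
    if "y \<in> carrier G" "a \<in> carrier G" "b \<in> carrier G" for y a b
    by (intro word_dist_le adjacent_power_translate word_dist_path that)
  from le[OF assms] show "word_dist (x \<otimes> g) (x \<otimes> h) \<le> word_dist g h" .
  from le[of "inv x" "x \<otimes> g" "x \<otimes> h"] assms
  show "word_dist g h \<le> word_dist (x \<otimes> g) (x \<otimes> h)"
    by (simp add: m_assoc[symmetric])
qed

section \<open>From triangles in the Cayley graph to the word metric\<close>

lemma edge_point_in_cayley_graph:
  "g \<in> carrier G \<Longrightarrow> s \<in> S \<Longrightarrow> t \<in> {0..1} \<Longrightarrow> edge_point G g s t \<in> cayley_graph G S"
  unfolding cayley_graph_def by blast

lemma cayley_path_append:
  assumes "cayley_path G S y m z" "cayley_path G S x l y"
  shows "cayley_path G S x (l + m) z"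
  using assms
proof induction
  case (segment y m g s t u)
  then have "cayley_path G S x ((l + m) + \<bar>t - u\<bar>) (edge_point G g s u)"
    by (intro cayley_path.segment) auto
  then show ?case by (simp add: add.assoc)
qed simp

lemma cayley_path_edge:
  assumes "g \<in> carrier G" "s \<in> S" "t \<in> {0..1}" "u \<in> {0..1}"
  shows "cayley_path G S (edge_point G g s t) \<bar>t - u\<bar> (edge_point G g s u)"
  using cayley_path.segment[OF cayley_path.trivial[OF edge_point_in_cayley_graph] assms] assms
  by simp

lemma cayley_path_sym: "cayley_path G S x l y \<Longrightarrow> cayley_path G S y l x"
proof (induction rule: cayley_path.induct)
  case (segment x l g s t u)
  have "cayley_path G S (edge_point G g s u) (\<bar>u - t\<bar> + l) x"
    by (rule cayley_path_append[OF segment.IH cayley_path_edge]) (use segment in auto)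
  then show ?case by (simp add: abs_minus_commute add.commute)
qed (rule cayley_path.trivial)

lemma cayley_path_nonneg: "cayley_path G S x l y \<Longrightarrow> 0 \<le> l"
  by (induction rule: cayley_path.induct) auto

lemma cayley_path_endpoint: "cayley_path G S x l y \<Longrightarrow> y \<in> cayley_graph G S"
  by (induction rule: cayley_path.induct) (auto intro: edge_point_in_cayley_graph)

lemma cayley_dist_le: "cayley_path G S x l y \<Longrightarrow> cayley_dist G S x y \<le> l"
  unfolding cayley_dist_def
  by (intro cInf_lower bdd_belowI[of _ 0]) (auto dest: cayley_path_nonneg)

lemma cayley_dist_ge:
  assumes "cayley_path G S x m y" "\<And>l. cayley_path G S x l y \<Longrightarrow> c \<le> l"
  shows "c \<le> cayley_dist G S x y"
  unfolding cayley_dist_def by (rule cInf_greatest) (use assms in blast)+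

text \<open>The word metric extends to the interior points of the edges by going to the nearer end.
  The extension is 1-Lipschitz along each edge, so no path of the Cayley graph is a shortcut
  compared with the word metric.\<close>

fun extended_word_dist :: "'a \<Rightarrow> 'a cayley_point \<Rightarrow> real" where
  "extended_word_dist a (Vertex h) = real (word_dist a h)"
| "extended_word_dist a (Inner h s u)
     = min (real (word_dist a h) + u) (real (word_dist a (h \<otimes> s)) + (1 - u))"

lemma extended_word_dist_edge_point:
  fixes t :: real
  assumes "a \<in> carrier G" "g \<in> carrier G" "s \<in> S" "t \<in> {0..1}"
  shows "extended_word_dist a (edge_point G g s t)
           = min (real (word_dist a g) + t) (real (word_dist a (g \<otimes> s)) + (1 - t))"
proof -
  have s: "s \<in> carrier G" using assms generators_subset by auto
  have "(g, g \<otimes> s) \<in> adjacent" using assms s by (auto simp: adjacent_def)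
  then have 1: "word_dist g (g \<otimes> s) \<le> 1" using word_dist_le[of g "g \<otimes> s" 1] by simp
  then have 2: "word_dist (g \<otimes> s) g \<le> 1" using word_dist_commute assms s by simp
  have "word_dist a g \<le> word_dist a (g \<otimes> s) + 1" "word_dist a (g \<otimes> s) \<le> word_dist a g + 1"
    using word_dist_triangle[of a g "g \<otimes> s"] word_dist_triangle[of a "g \<otimes> s" g] assms s 1 2
    by auto
  then have le: "real (word_dist a g) \<le> real (word_dist a (g \<otimes> s)) + 1"
    "real (word_dist a (g \<otimes> s)) \<le> real (word_dist a g) + 1"
    by linarith+
  consider "t = 0" | "t = 1" | "t \<noteq> 0" "t \<noteq> 1" by blast
  then show ?thesis
  proof cases
    case 1
    then show ?thesis using le(1) by (simp add: edge_point_def)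
  next
    case 2
    then show ?thesis using le(2) by (simp add: edge_point_def)
  qed (simp add: edge_point_def)
qed

lemma extended_word_dist_le_path:
  assumes "cayley_path G S x l y" "x = Vertex a" "a \<in> carrier G"
  shows "extended_word_dist a y \<le> l"
  using assms
proof (induction rule: cayley_path.induct)
  case (segment x l g s t u)
  have "min (c + u) (d + (1 - u)) \<le> min (c + t) (d + (1 - t)) + \<bar>t - u\<bar>" for c d :: real
    by linarith
  with segment have "extended_word_dist a (edge_point G g s u)
             \<le> extended_word_dist a (edge_point G g s t) + \<bar>t - u\<bar>"
    by (simp only: extended_word_dist_edge_point)
  with segment show ?case by simp
qed simp

lemma adjacent_edge:
  assumes "(g, h) \<in> adjacent"
  shows "\<exists>e. e 0 = Vertex g \<and> e 1 = Vertex h \<and>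
    (\<forall>t\<in>{0..1}. \<forall>u\<in>{0..1}. cayley_path G S (e t) \<bar>t - u\<bar> (e u))"
proof -
  from assms obtain s where gh: "g \<in> carrier G" "h \<in> carrier G" and s: "s \<in> S"
    "h = g \<otimes> s \<or> g = h \<otimes> s" unfolding adjacent_def by blast
  from s(2) show ?thesis
  proof
    assume "h = g \<otimes> s"
    then show ?thesis using cayley_path_edge[OF gh(1) s(1)]
      by (intro exI[of _ "edge_point G g s"]) (auto simp: edge_point_def)
  next
    assume g: "g = h \<otimes> s"
    have "cayley_path G S (edge_point G h s (1 - t)) \<bar>t - u\<bar> (edge_point G h s (1 - u))"
      if "t \<in> {0..1}" "u \<in> {0..1}" for t u :: real
    proof -
      have "\<bar>(1 - t) - (1 - u)\<bar> = \<bar>t - u\<bar>" by linarith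
      then show ?thesis using cayley_path_edge[OF gh(2) s(1), of "1 - t" "1 - u"] that by simp
    qed
    then show ?thesis using g
      by (intro exI[of _ "\<lambda>t. edge_point G h s (1 - t)"]) (auto simp: edge_point_def)
  qed
qed

text \<open>A vertex path realising the word distance, traversed at unit speed, is a geodesic of the
  Cayley graph: a shorter connection between two of its points would shorten the whole path.
  Going through a prescribed vertex \<open>v\<close> between \<open>a\<close> and \<open>b\<close> makes the fine triangle condition
  available at all such \<open>v\<close>.\<close>

lemma geodesic_through:
  assumes a: "a \<in> carrier G" and b: "b \<in> carrier G" and v: "v \<in> carrier G"
    and between: "word_dist a v + word_dist v b = word_dist a b"
  obtains \<gamma> where "\<gamma> 0 = Vertex a" "\<gamma> (real (word_dist a b)) = Vertex b"
    "\<gamma> (real (word_dist a v)) = Vertex v"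
    "\<And>s t. s \<in> {0..real (word_dist a b)} \<Longrightarrow> t \<in> {0..real (word_dist a b)} \<Longrightarrow>
       cayley_dist G S (\<gamma> s) (\<gamma> t) = \<bar>s - t\<bar>"
    "geodesic_segment G S (Vertex a) (Vertex b) (\<gamma> ` {0..real (word_dist a b)})"
proof -
  define L where "L = word_dist a b"
  define m where "m = word_dist a v"
  from word_dist_path[OF a v] obtain f1 where f1: "f1 0 = a" "f1 m = v"
    "\<And>i. i < m \<Longrightarrow> (f1 i, f1 (Suc i)) \<in> adjacent" unfolding m_def relpow_fun_conv by blast
  from word_dist_path[OF v b] obtain f2 where f2: "f2 0 = v" "f2 (word_dist v b) = b"
    "\<And>i. i < word_dist v b \<Longrightarrow> (f2 i, f2 (Suc i)) \<in> adjacent" unfolding relpow_fun_conv by blast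
  define f where "f i = (if i \<le> m then f1 i else f2 (i - m))" for i
  have L: "L = m + word_dist v b" using between by (simp add: L_def m_def)
  have f: "f 0 = a" "f m = v" "f L = b" using f1 f2 L by (auto simp: f_def)
  have adj: "(f i, f (Suc i)) \<in> adjacent" if "i < L" for i
  proof -
    consider "i < m" | "i = m" | "i > m" by linarith
    then show ?thesis
    proof cases
      case 2
      then show ?thesis using f2(1) f2(3)[of 0] f1(2) that L by (simp add: f_def)
    next
      case 3
      then show ?thesis using f2(3)[of "i - m"] that L by (simp add: f_def Suc_diff_le)
    qed (use f1(3) in \<open>auto simp: f_def\<close>)
  qed
  have "\<exists>e. \<forall>i<L. e i 0 = Vertex (f i) \<and> e i 1 = Vertex (f (Suc i)) \<and>
      (\<forall>t\<in>{0..1}. \<forall>u\<in>{0..1::real}. cayley_path G S (e i t) \<bar>t - u\<bar> (e i u))"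
    by (rule choice) (use adjacent_edge[OF adj] in blast)
  then obtain e where e: "\<And>i. i < L \<Longrightarrow> e i (0::real) = Vertex (f i)"
      "\<And>i. i < L \<Longrightarrow> e i 1 = Vertex (f (Suc i))"
      "\<And>i t u. i < L \<Longrightarrow> t \<in> {0..1} \<Longrightarrow> u \<in> {0..1} \<Longrightarrow> cayley_path G S (e i t) \<bar>t - u\<bar> (e i u)"
    by blast
  define \<gamma> where
    "\<gamma> t = (if t < real L then e (nat \<lfloor>t\<rfloor>) (t - of_int \<lfloor>t\<rfloor>) else Vertex (f L))" for t :: real
  have vertex: "\<gamma> (real i) = Vertex (f i)" if "i \<le> L" for i
    using that e(1)[of i] by (auto simp: \<gamma>_def)
  have on_edge: "\<gamma> t = e i (t - real i)" if "i < L" "real i \<le> t" "t \<le> real i + 1" for i t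
  proof (cases "t = real i + 1")
    case True
    then show ?thesis using vertex[of "Suc i"] e(2)[of i] that by (simp add: add.commute)
  next
    case False
    then have "\<lfloor>t\<rfloor> = int i" "t < real L" using that by linarith+
    then show ?thesis by (simp add: \<gamma>_def)
  qed
  have path_up: "\<forall>s t. 0 \<le> s \<and> s \<le> t \<and> t \<le> real n \<longrightarrow> cayley_path G S (\<gamma> s) (t - s) (\<gamma> t)"
    if "n \<le> L" for n
    using that
  proof (induction n)
    case 0
    have "cayley_path G S (\<gamma> 0) 0 (\<gamma> 0)"
      using vertex[of 0] a f by (auto intro!: cayley_path.trivial simp: cayley_graph_def)
    moreover have "s = 0" "t = 0" if "0 \<le> s \<and> s \<le> t \<and> t \<le> real 0" for s t :: real
      using that by auto
    ultimately show ?case by (metis diff_self)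
  next
    case (Suc n)
    show ?case
    proof (intro allI impI)
      fix s t assume st: "0 \<le> s \<and> s \<le> t \<and> t \<le> real (Suc n)"
      have edge: "cayley_path G S (\<gamma> s') (t - s') (\<gamma> t)" if "real n \<le> s'" "s' \<le> t" for s'
        using e(3)[of n "s' - real n" "t - real n"] on_edge[of n s'] on_edge[of n t] that st Suc
        by (simp add: abs_if split: if_splits)
      consider "real n \<le> s" | "t \<le> real n" | "s < real n" "real n < t" by linarith
      then show "cayley_path G S (\<gamma> s) (t - s) (\<gamma> t)"
      proof cases
        case 3
        have "cayley_path G S (\<gamma> s) (real n - s) (\<gamma> (real n))" using Suc st 3 by auto
        from cayley_path_append[OF edge[of "real n"] this] 3 show ?thesis by simp
      qed (use edge st Suc in auto)
    qed
  qed
  have path_le: "cayley_path G S (\<gamma> s) (t - s) (\<gamma> t)" if "0 \<le> s" "s \<le> t" "t \<le> real L" for s t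
    using path_up[of L] that by blast
  have dist_le: "cayley_dist G S (\<gamma> s) (\<gamma> t) = t - s" and dist_ge: "cayley_dist G S (\<gamma> t) (\<gamma> s) = t - s"
    if st: "0 \<le> s" "s \<le> t" "t \<le> real L" for s t
  proof -
    have long: "t - s \<le> l" if l: "cayley_path G S (\<gamma> s) l (\<gamma> t)" for l
    proof -
      have "cayley_path G S (\<gamma> 0) ((s - 0) + l) (\<gamma> t)"
        by (rule cayley_path_append[OF l path_le]) (use st in auto)
      from cayley_path_append[OF path_le this, of "real L"]
      have "cayley_path G S (Vertex a) (s + l + (real L - t)) (Vertex b)"
        using st vertex[of 0] vertex[of L] f by simp
      from extended_word_dist_le_path[OF this refl a] show ?thesis by (simp add: L_def)
    qed
    show "cayley_dist G S (\<gamma> s) (\<gamma> t) = t - s"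
      using path_le[OF st] by (rule antisym[OF cayley_dist_le cayley_dist_ge]) (rule path_le[OF st] long, assumption?)+
    note rev = cayley_path_sym[OF path_le[OF st]]
    show "cayley_dist G S (\<gamma> t) (\<gamma> s) = t - s"
      by (rule antisym[OF cayley_dist_le[OF rev] cayley_dist_ge[OF rev]])
        (rule long, rule cayley_path_sym)
  qed
  have dist: "cayley_dist G S (\<gamma> s) (\<gamma> t) = \<bar>s - t\<bar>" if "s \<in> {0..real L}" "t \<in> {0..real L}" for s t
    using dist_le[of s t] dist_ge[of t s] that by (cases "s \<le> t") auto
  have range: "\<gamma> ` {0..real L} \<subseteq> cayley_graph G S"
    using path_le[of 0] cayley_path_endpoint by fastforce
  have ends: "\<gamma> 0 = Vertex a" "\<gamma> (real L) = Vertex b" "\<gamma> (real m) = Vertex v"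
    using vertex[of 0] vertex[of L] vertex[of m] f L by auto
  have "geodesic_segment G S (Vertex a) (Vertex b) (\<gamma> ` {0..real L})"
    unfolding geodesic_segment_def
    by (intro exI[of _ "real L"] exI[of _ \<gamma>] conjI ballI dist range ends) auto
  with that ends dist show ?thesis unfolding L_def m_def by blast
qed

text \<open>Only the fine triangle condition at vertices \<open>v\<close>, \<open>w\<close> is retained.  The three points at
  the Gromov products, which may be midpoints of edges, enter only through their parameters on
  the sides.\<close>

lemma thin_from_fine_triangles:
  assumes fine: "fine_triangles G S \<delta>"
    and V: "a \<in> carrier G" "b \<in> carrier G" "c \<in> carrier G" "v \<in> carrier G" "w \<in> carrier G"
    and v: "word_dist a v + word_dist v b = word_dist a b"
    and w: "word_dist a w + word_dist w c = word_dist a c"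
    and vw: "word_dist a v = word_dist a w"
    and below: "2 * word_dist a v + word_dist b c \<le> word_dist a b + word_dist a c"
  shows "real (word_dist v w) \<le> \<delta>"
proof -
  note sym = word_dist_commute
  let ?ab = "real (word_dist a b)" and ?bc = "real (word_dist b c)" and ?ca = "real (word_dist c a)"
  have w': "word_dist c w + word_dist w a = word_dist c a"
    using w sym[of a w] sym[of c w] sym[of a c] V by simp
  obtain \<gamma>1 where \<gamma>1: "\<gamma>1 0 = Vertex a" "\<gamma>1 ?ab = Vertex b" "\<gamma>1 (real (word_dist a v)) = Vertex v"
    "\<And>s t. s \<in> {0..?ab} \<Longrightarrow> t \<in> {0..?ab} \<Longrightarrow> cayley_dist G S (\<gamma>1 s) (\<gamma>1 t) = \<bar>s - t\<bar>"
    "geodesic_segment G S (Vertex a) (Vertex b) (\<gamma>1 ` {0..?ab})"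
    using geodesic_through[OF V(1,2,4) v] by blast
  obtain \<gamma>2 where \<gamma>2: "\<gamma>2 0 = Vertex b" "\<gamma>2 ?bc = Vertex c"
    "\<And>s t. s \<in> {0..?bc} \<Longrightarrow> t \<in> {0..?bc} \<Longrightarrow> cayley_dist G S (\<gamma>2 s) (\<gamma>2 t) = \<bar>s - t\<bar>"
    "geodesic_segment G S (Vertex b) (Vertex c) (\<gamma>2 ` {0..?bc})"
    using geodesic_through[OF V(2,3,2)] by auto
  obtain \<gamma>3 where \<gamma>3: "\<gamma>3 0 = Vertex c" "\<gamma>3 ?ca = Vertex a" "\<gamma>3 (real (word_dist c w)) = Vertex w"
    "\<And>s t. s \<in> {0..?ca} \<Longrightarrow> t \<in> {0..?ca} \<Longrightarrow> cayley_dist G S (\<gamma>3 s) (\<gamma>3 t) = \<bar>s - t\<bar>"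
    "geodesic_segment G S (Vertex c) (Vertex a) (\<gamma>3 ` {0..?ca})"
    using geodesic_through[OF V(3,1,5) w'] by blast
  define r where "r = (?ab + ?ca - ?bc) / 2"
  have tri: "?ab \<le> ?ca + ?bc" "?bc \<le> ?ab + ?ca" "?ca \<le> ?ab + ?bc"
    using word_dist_triangle[of a c b] word_dist_triangle[of b a c] word_dist_triangle[of c b a]
      sym[of a c] sym[of a b] sym[of b c] V by linarith+
  have r: "0 \<le> r" "r \<le> ?ab" "r \<le> ?ca" "?ab - r \<le> ?bc" "?bc - (?ab - r) = ?ca - r"
    using tri by (auto simp: r_def field_simps)
  have vr: "real (word_dist a v) \<le> r"
    using below sym[of a c] V by (simp add: r_def)
  have aw: "real (word_dist c w) = ?ca - real (word_dist a v)"
    using w' vw sym[of a w] V by linarith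
  have in1: "0 \<in> {0..?ab}" "?ab \<in> {0..?ab}" "r \<in> {0..?ab}" "real (word_dist a v) \<in> {0..?ab}"
    using r vr by auto
  have in2: "0 \<in> {0..?bc}" "?bc \<in> {0..?bc}" "?ab - r \<in> {0..?bc}"
    using r by auto
  have in3: "0 \<in> {0..?ca}" "?ca \<in> {0..?ca}" "?ca - r \<in> {0..?ca}" "real (word_dist c w) \<in> {0..?ca}"
    using r vr aw by auto
  have D1: "cayley_dist G S (Vertex b) (\<gamma>1 r) = ?ab - r"
    "cayley_dist G S (Vertex a) (\<gamma>1 r) = r"
    "cayley_dist G S (Vertex a) (Vertex v) = real (word_dist a v)"
    using \<gamma>1(4)[OF in1(2,3)] \<gamma>1(4)[OF in1(1,3)] \<gamma>1(4)[OF in1(1,4)] \<gamma>1(1-3) r by auto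
  have D2: "cayley_dist G S (Vertex b) (\<gamma>2 (?ab - r)) = ?ab - r"
    "cayley_dist G S (Vertex c) (\<gamma>2 (?ab - r)) = ?ca - r"
    using \<gamma>2(3)[OF in2(1,3)] \<gamma>2(3)[OF in2(2,3)] \<gamma>2(1,2) r by auto
  have D3: "cayley_dist G S (Vertex c) (\<gamma>3 (?ca - r)) = ?ca - r"
    "cayley_dist G S (Vertex a) (\<gamma>3 (?ca - r)) = r"
    "cayley_dist G S (Vertex a) (Vertex w) = real (word_dist a v)"
    using \<gamma>3(4)[OF in3(1,3)] \<gamma>3(4)[OF in3(2,3)] \<gamma>3(4)[OF in3(2,4)] \<gamma>3(1-3) r aw by auto
  have mem: "\<gamma>2 (?ab - r) \<in> \<gamma>2 ` {0..?bc}" "Vertex v \<in> \<gamma>1 ` {0..?ab}" "\<gamma>1 r \<in> \<gamma>1 ` {0..?ab}"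
    "Vertex w \<in> \<gamma>3 ` {0..?ca}" "\<gamma>3 (?ca - r) \<in> \<gamma>3 ` {0..?ca}"
    using in1 in2 in3 \<gamma>1(3) \<gamma>3(3) by (metis imageI)+
  have "cayley_dist G S (Vertex v) (Vertex w) \<le> \<delta>"
    using fine[unfolded fine_triangles_def, rule_format, OF V(1-3) \<gamma>1(5) \<gamma>2(4) \<gamma>3(5) mem]
      D1 D2 D3 vr by simp
  moreover have "real (word_dist v w) \<le> cayley_dist G S (Vertex v) (Vertex w)"
  proof -
    obtain \<gamma> where g: "\<gamma> 0 = Vertex v" "\<gamma> (real (word_dist v w)) = Vertex w"
      "\<And>s t. s \<in> {0..real (word_dist v w)} \<Longrightarrow> t \<in> {0..real (word_dist v w)} \<Longrightarrow>
         cayley_dist G S (\<gamma> s) (\<gamma> t) = \<bar>s - t\<bar>"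
      using geodesic_through[OF V(4,5,4)] by (metis add_0 word_dist_self)
    show ?thesis using g(3)[of 0 "real (word_dist v w)"] g(1,2) by simp
  qed
  ultimately show ?thesis by linarith
qed

end

section \<open>Means and coupling\<close>

definition mean :: "'a set \<Rightarrow> ('a \<Rightarrow> real) \<Rightarrow> real" where
  "mean A f = (\<Sum>a\<in>A. f a) / real (card A)"

lemma mean_nonneg: "(\<And>a. a \<in> A \<Longrightarrow> 0 \<le> f a) \<Longrightarrow> 0 \<le> mean A f"
  by (simp add: mean_def sum_nonneg)

lemma mean_le_1:
  assumes "\<And>a. a \<in> A \<Longrightarrow> f a \<le> 1"
  shows "mean A f \<le> 1"
proof (cases "finite A \<and> A \<noteq> {}")
  case True
  then have "0 < real (card A)" by (simp add: card_gt_0_iff)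
  moreover have "(\<Sum>a\<in>A. f a) \<le> real (card A)"
    using sum_bounded_above[of A f 1] assms by simp
  ultimately show ?thesis by (simp add: mean_def)
qed (auto simp: mean_def)

lemma mean_nonzero: "mean A f \<noteq> 0 \<Longrightarrow> \<exists>a\<in>A. f a \<noteq> 0"
  by (metis div_0 mean_def sum.neutral)

lemma mean_image: "inj_on g A \<Longrightarrow> mean (g ` A) f = mean A (\<lambda>a. f (g a))"
  by (simp add: mean_def sum.reindex card_image)

lemma sum_mean: "(\<Sum>z\<in>Z. mean A (f z)) = mean A (\<lambda>a. \<Sum>z\<in>Z. f z a)"
  unfolding mean_def sum_divide_distrib[symmetric] by (subst sum.swap) simp

text \<open>Draw \<open>a\<close> and \<open>b\<close> independently: with probability at least \<open>1 / N\<^sup>2\<close> both are the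
  common point, and then \<open>f a - f b\<close> vanishes.\<close>

lemma mean_coupling:
  assumes fin: "finite A" "finite B" and c: "c \<in> A" "c \<in> B"
    and N: "card A \<le> N" "card B \<le> N"
    and diff: "\<And>a b. a \<in> A \<Longrightarrow> b \<in> B \<Longrightarrow> \<bar>f a - f b\<bar> \<le> e"
  shows "\<bar>mean A f - mean B f\<bar> \<le> (1 - 1 / (real N)\<^sup>2) * e"
proof -
  let ?m = "real (card A)" and ?n = "real (card B)"
  have pos: "0 < card A" "0 < card B" using fin c by (auto simp: card_gt_0_iff)
  then have mn: "1 \<le> ?m * ?n" "0 < ?m * ?n" by (auto simp: mult_ge1_I)
  have "(\<Sum>(a, b)\<in>A \<times> B. f a - f b) = (\<Sum>a\<in>A. \<Sum>b\<in>B. f a - f b)"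
    using fin by (simp add: sum.cartesian_product)
  also have "\<dots> = ?n * (\<Sum>a\<in>A. f a) - ?m * (\<Sum>b\<in>B. f b)"
    by (simp add: sum_subtractf sum_distrib_left)
  finally have eq: "mean A f - mean B f = (\<Sum>(a, b)\<in>A \<times> B. f a - f b) / (?m * ?n)"
    using pos by (simp add: mean_def field_simps)
  have "(\<Sum>(a, b)\<in>A \<times> B. f a - f b) = (\<Sum>(a, b)\<in>A \<times> B - {(c, c)}. f a - f b)"
    by (rule sum.mono_neutral_right) (use fin in auto)
  also have "\<bar>\<dots>\<bar> \<le> (\<Sum>(a, b)\<in>A \<times> B - {(c, c)}. e)"
    by (rule order.trans[OF sum_abs], rule sum_mono) (use diff in auto)
  also have "\<dots> = (?m * ?n - 1) * e"
    using fin c mn by (simp add: card_Diff_singleton card_cartesian_product of_nat_diff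
        Suc_le_eq pos case_prod_unfold)
  finally have "\<bar>mean A f - mean B f\<bar> \<le> ((?m * ?n - 1) * e) / (?m * ?n)"
    using mn unfolding eq by (simp add: divide_right_mono)
  also have "\<dots> = (1 - 1 / (?m * ?n)) * e" using pos by (simp add: field_simps)
  also have "\<dots> \<le> (1 - 1 / (real N)\<^sup>2) * e"
  proof (rule mult_right_mono)
    have "?m * ?n \<le> (real N)\<^sup>2" using N by (simp add: power2_eq_square mult_mono)
    then show "1 - 1 / (?m * ?n) \<le> 1 - 1 / (real N)\<^sup>2"
      using mn by (simp add: frac_le)
    show "0 \<le> e" using diff[OF c] by simp
  qed
  finally show ?thesis .
qed

lemma norm_add_powr_le:
  fixes x y :: "'b::real_normed_vector"
  assumes "0 \<le> p"
  shows "norm (x + y) powr p \<le> 2 powr p * (norm x powr p + norm y powr p)"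
proof -
  let ?m = "max (norm x) (norm y)"
  have "norm (x + y) \<le> 2 * ?m" using norm_triangle_ineq[of x y] by linarith
  then have "norm (x + y) powr p \<le> 2 powr p * ?m powr p"
    using assms powr_mono2[of p "norm (x + y)" "2 * ?m"] by (simp add: powr_mult)
  also have "?m powr p \<le> norm x powr p + norm y powr p" by (simp add: max_def)
  finally show ?thesis by (simp add: mult_left_mono)
qed

section \<open>Graphs of bounded degree\<close>

locale graph_metric =
  fixes X :: "'a set" and d :: "'a \<Rightarrow> 'a \<Rightarrow> nat" and D :: nat
  assumes dist_eq_0: "x \<in> X \<Longrightarrow> y \<in> X \<Longrightarrow> d x y = 0 \<longleftrightarrow> x = y"
    and dist_commute: "x \<in> X \<Longrightarrow> y \<in> X \<Longrightarrow> d x y = d y x"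
    and dist_triangle: "x \<in> X \<Longrightarrow> y \<in> X \<Longrightarrow> z \<in> X \<Longrightarrow> d x z \<le> d x y + d y z"
    and intermediate: "x \<in> X \<Longrightarrow> y \<in> X \<Longrightarrow> n \<le> d x y \<Longrightarrow>
          \<exists>v\<in>X. d x v = n \<and> d v y = d x y - n"
    and finite_unit_sphere: "x \<in> X \<Longrightarrow> finite {y \<in> X. d x y = 1}"
    and card_unit_sphere: "x \<in> X \<Longrightarrow> card {y \<in> X. d x y = 1} \<le> D"
begin

definition vertex_ball :: "'a \<Rightarrow> nat \<Rightarrow> 'a set" where
  "vertex_ball x r = {y \<in> X. d x y \<le> r}"

definition ball_bound :: "nat \<Rightarrow> nat" where
  "ball_bound r = (\<Sum>i\<le>r. D ^ i)"

lemma sphere_bound: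
  assumes "x \<in> X"
  shows "finite {y \<in> X. d x y = n} \<and> card {y \<in> X. d x y = n} \<le> D ^ n"
proof (induction n)
  case 0
  have "{y \<in> X. d x y = 0} = {x}" using dist_eq_0[OF assms] assms by auto
  then show ?case by simp
next
  case (Suc n)
  let ?S = "{y \<in> X. d x y = n}"
  have sub: "{y \<in> X. d x y = Suc n} \<subseteq> (\<Union>v\<in>?S. {y \<in> X. d v y = 1})"
  proof
    fix y assume y: "y \<in> {y \<in> X. d x y = Suc n}"
    then obtain v where "v \<in> X" "d x v = n" "d v y = d x y - n"
      using intermediate[OF assms, of y n] by auto
    with y show "y \<in> (\<Union>v\<in>?S. {y \<in> X. d v y = 1})" by auto
  qed
  have fin: "finite (\<Union>v\<in>?S. {y \<in> X. d v y = 1})"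
    using Suc finite_unit_sphere by auto
  have "card {y \<in> X. d x y = Suc n} \<le> card (\<Union>v\<in>?S. {y \<in> X. d v y = 1})"
    by (rule card_mono[OF fin sub])
  also have "\<dots> \<le> (\<Sum>v\<in>?S. card {y \<in> X. d v y = 1})"
    using Suc by (intro card_UN_le) auto
  also have "\<dots> \<le> (\<Sum>v\<in>?S. D)" using card_unit_sphere by (intro sum_mono) auto
  also have "\<dots> \<le> D ^ Suc n" using Suc by simp
  finally show ?case using finite_subset[OF sub fin] by blast
qed

lemma countable_vertices: "countable X"
proof (cases "X = {}")
  case False
  then obtain x where x: "x \<in> X" by blast
  have "X = (\<Union>n. {y \<in> X. d x y = n})" by auto
  moreover have "countable (\<Union>n. {y \<in> X. d x y = n})"
    using sphere_bound[OF x] by (intro countable_UN countableI_type countable_finite) blast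
  ultimately show ?thesis by metis
qed simp

lemma ball_bound:
  assumes "x \<in> X"
  shows finite_vertex_ball: "finite (vertex_ball x r)" and card_vertex_ball: "card (vertex_ball x r) \<le> ball_bound r"
proof -
  have eq: "vertex_ball x r = (\<Union>i\<le>r. {y \<in> X. d x y = i})" by (auto simp: vertex_ball_def)
  show "finite (vertex_ball x r)" unfolding eq using sphere_bound[OF assms] by auto
  have "card (vertex_ball x r) \<le> (\<Sum>i\<le>r. card {y \<in> X. d x y = i})"
    unfolding eq by (rule card_UN_le) simp
  also have "\<dots> \<le> ball_bound r"
    unfolding ball_bound_def using sphere_bound[OF assms] by (intro sum_mono) auto
  finally show "card (vertex_ball x r) \<le> ball_bound r" .
qed

lemma ball_bound_pos: "1 \<le> ball_bound r"
proof -
  have "D ^ 0 \<le> ball_bound r" unfolding ball_bound_def by (rule member_le_sum) auto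
  then show ?thesis by simp
qed

lemma sum_exponential_decay:
  fixes \<theta> :: real
  assumes "0 < \<theta>" "\<theta> * D \<le> 1 / 2" "finite A" "A \<subseteq> X" "a \<in> X"
  shows "(\<Sum>x\<in>A. \<theta> ^ d x a) \<le> 2"
proof -
  define m where "m = Max (insert 0 ((\<lambda>x. d x a) ` A))"
  have m: "(\<lambda>x. d x a) ` A \<subseteq> {..m}" using assms(3) by (auto simp: m_def)
  have "(\<Sum>x\<in>A. \<theta> ^ d x a) = (\<Sum>n\<le>m. \<Sum>x\<in>{x \<in> A. d x a = n}. \<theta> ^ d x a)"
    by (rule sum.group[symmetric]) (use assms m in auto)
  also have "\<dots> \<le> (\<Sum>n\<le>m. (1 / 2) ^ n)"
  proof (rule sum_mono)
    fix n
    have "{x \<in> A. d x a = n} \<subseteq> {x \<in> X. d a x = n}" using assms dist_commute by auto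
    then have card: "card {x \<in> A. d x a = n} \<le> D ^ n"
      using sphere_bound[OF assms(5)] by (meson card_mono order.trans)
    have "(\<Sum>x\<in>{x \<in> A. d x a = n}. \<theta> ^ d x a) = card {x \<in> A. d x a = n} * \<theta> ^ n" by simp
    also have "\<dots> \<le> real (D ^ n) * \<theta> ^ n"
      by (intro mult_right_mono) (use card assms(1) in \<open>auto simp del: of_nat_power\<close>)
    also have "\<dots> = (\<theta> * D) ^ n" by (simp add: power_mult_distrib mult.commute)
    also have "\<dots> \<le> (1 / 2) ^ n" by (intro power_mono) (use assms in auto)
    finally show "(\<Sum>x\<in>{x \<in> A. d x a = n}. \<theta> ^ d x a) \<le> (1 / 2) ^ n" .
  qed
  also have "\<dots> = 2 - (1 / 2 :: real) ^ m" by (induction m) auto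
  also have "\<dots> \<le> 2" by simp
  finally show ?thesis .
qed

end

section \<open>Hitting probabilities of the descent towards a vertex\<close>

text \<open>The jump length \<open>k\<close> exceeds \<open>10 * h\<close> for two reasons: descents that are within \<open>10 * h\<close>
  of each other on one sphere then have overlapping shadows on the next one, and points of a
  geodesic at distance \<open>2 * k\<close> have disjoint neighbourhoods of radius \<open>10 * h\<close>.\<close>

locale hyperbolic_graph = graph_metric +
  fixes h k :: nat
  assumes thin: "\<lbrakk>x \<in> X; y \<in> X; y' \<in> X; v \<in> X; w \<in> X;
      d x v + d v y = d x y; d x w + d w y' = d x y'; d x v = d x w;
      2 * d x v + d y y' \<le> d x y + d x y'\<rbrakk> \<Longrightarrow> d v w \<le> 2 * h"
    and h_pos: "1 \<le> h"
    and k_large: "10 * h < k"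
begin

text \<open>The endpoints at distance \<open>t\<close> from \<open>x\<close> of approximate geodesics from \<open>y\<close> towards \<open>x\<close>.
  The tolerance \<open>2 * h\<close> is what makes the shadows of nearby vertices overlap.\<close>

definition shadow :: "'a \<Rightarrow> nat \<Rightarrow> 'a \<Rightarrow> 'a set" where
  "shadow x t y = {w \<in> X. d x w = t \<and> d w y + t \<le> d x y + 2 * h}"

lemma geodesic_point_in_shadow:
  "v \<in> X \<Longrightarrow> d x v = t \<Longrightarrow> d x v + d v y = d x y \<Longrightarrow> v \<in> shadow x t y"
  by (auto simp: shadow_def)

lemma shadow_near_geodesic:
  assumes X: "x \<in> X" "y \<in> X" "v \<in> X" and w: "w \<in> shadow x t y"
    and v: "d x v = t" "d x v + d v y = d x y"
  shows "d w v \<le> 4 * h"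
proof -
  have wX: "w \<in> X" and wt: "d x w = t" "d w y + t \<le> d x y + 2 * h"
    using w by (auto simp: shadow_def)
  \<comment> \<open>The Gromov product of \<open>w\<close> and \<open>y\<close> is at least \<open>t - h\<close>; compare the geodesics there.\<close>
  define s where "s = t - h"
  have s: "s \<le> t" "t - s \<le> h" by (auto simp: s_def)
  obtain w' where w': "w' \<in> X" "d x w' = s" "d w' w = t - s"
    using intermediate[OF X(1) wX, of s] wt s by auto
  obtain v' where v': "v' \<in> X" "d x v' = s" "d v' v = t - s"
    using intermediate[OF X(1,3), of s] v s by auto
  have "d v' y \<le> d v' v + d v y" "d x y \<le> d x v' + d v' y"
    using dist_triangle[OF v'(1) X(3,2)] dist_triangle[OF X(1) v'(1) X(2)] by auto
  then have v'y: "d x v' + d v' y = d x y" using v v' s by linarith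
  have "2 * s + d w y \<le> t + d x y"
    using wt dist_triangle[of w x y] dist_commute[of w x] X wX by (cases "h \<le> t") (auto simp: s_def)
  then have "d w' v' \<le> 2 * h"
    using thin[OF X(1) wX X(2) w'(1) v'(1)] w' v' v'y wt s by auto
  moreover have "d w v \<le> d w w' + (d w' v' + d v' v)"
    using dist_triangle[of w w' v] dist_triangle[of w' v' v] X wX w' v' by fastforce
  ultimately show ?thesis using w' v' s dist_commute[OF wX w'(1)] by linarith
qed

text \<open>As long as \<open>t\<close> is at most the Gromov product of \<open>y\<close> and \<open>y'\<close>, geodesics from \<open>x\<close> to these
  points are within \<open>2 * h\<close> of each other at distance \<open>t\<close>, and the shadows lie within \<open>4 * h\<close> of
  them.  The resulting bound \<open>10 * h\<close> does not depend on how far apart \<open>y\<close> and \<open>y'\<close> are, which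
  is why it reproduces itself along the descent.\<close>

lemma shadows_meet:
  assumes X: "x \<in> X" "y \<in> X" "y' \<in> X" and t: "t \<le> d x y" "t \<le> d x y'"
    and product: "2 * t + d y y' \<le> d x y + d x y'"
  shows "\<exists>v. v \<in> shadow x t y \<and> v \<in> shadow x t y'"
    and "w \<in> shadow x t y \<Longrightarrow> w' \<in> shadow x t y' \<Longrightarrow> d w w' \<le> 10 * h"
proof -
  obtain v where v: "v \<in> X" "d x v = t" "d v y = d x y - t" using intermediate X t by blast
  obtain v' where v': "v' \<in> X" "d x v' = t" "d v' y' = d x y' - t" using intermediate X t by blast
  have vv': "d v v' \<le> 2 * h"
    using thin[OF X v(1) v'(1)] v v' t product by auto
  have "d v y' \<le> d v v' + d v' y'" by (rule dist_triangle[OF v(1) v'(1) X(3)])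
  then have "v \<in> shadow x t y'" using vv' v v' t by (auto simp: shadow_def)
  then show "\<exists>v. v \<in> shadow x t y \<and> v \<in> shadow x t y'"
    using geodesic_point_in_shadow[of v x t y] v t by auto
  assume w: "w \<in> shadow x t y" and w': "w' \<in> shadow x t y'"
  have "w \<in> X" "w' \<in> X" using w w' by (auto simp: shadow_def)
  then have "d w w' \<le> d w v + (d v v' + d v' w')" "d v' w' = d w' v'"
    using dist_triangle[of w v w'] dist_triangle[of v v' w'] dist_commute v v' by fastforce+
  moreover have "d w v \<le> 4 * h" "d w' v' \<le> 4 * h"
    using shadow_near_geodesic[OF X(1,2) v(1) w] shadow_near_geodesic[OF X(1,3) v'(1) w'] v v' t
    by auto
  ultimately show "d w w' \<le> 10 * h" using vv' by linarith
qed

definition shadow_bound :: nat where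
  "shadow_bound = ball_bound (4 * h) + 1"

lemma shadow_finite:
  assumes "x \<in> X" "y \<in> X" "t \<le> d x y"
  shows "finite (shadow x t y)" "card (shadow x t y) \<le> shadow_bound" "shadow x t y \<noteq> {}"
proof -
  obtain v where v: "v \<in> X" "d x v = t" "d v y = d x y - t" using intermediate assms by blast
  have "d v w \<le> 4 * h" if "w \<in> shadow x t y" for w
    using shadow_near_geodesic[OF assms(1,2) v(1) that] v assms dist_commute[of v w] that
    by (auto simp: shadow_def)
  then have sub: "shadow x t y \<subseteq> vertex_ball v (4 * h)" by (auto simp: vertex_ball_def shadow_def)
  then show "finite (shadow x t y)" using finite_vertex_ball[OF v(1)] finite_subset by blast
  show "card (shadow x t y) \<le> shadow_bound"
    using card_mono[OF finite_vertex_ball[OF v(1)] sub] card_vertex_ball[OF v(1), of "4 * h"]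
    by (simp add: shadow_bound_def)
  show "shadow x t y \<noteq> {}" using geodesic_point_in_shadow[of v x t y] v assms by auto
qed

text \<open>The probability that the random descent towards \<open>x\<close> which starts at \<open>y\<close>, jumps uniformly
  into the shadows at distances \<open>j * k\<close>, \<dots>, \<open>2 * k\<close>, \<open>k\<close> and then stops, ends in \<open>z\<close>.\<close>

primrec hit :: "nat \<Rightarrow> 'a \<Rightarrow> 'a \<Rightarrow> 'a \<Rightarrow> real" where
  "hit 0 x z y = of_bool (y = z)"
| "hit (Suc j) x z y = mean (shadow x (Suc j * k) y) (hit j x z)"

text \<open>The number of jumps is chosen such that the first one covers between \<open>1\<close> and \<open>k\<close>.\<close>

definition level :: "nat \<Rightarrow> nat" where
  "level n = (n - 1) div k"

definition hitting :: "'a \<Rightarrow> 'a \<Rightarrow> 'a \<Rightarrow> real" where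
  "hitting x z y = hit (level (d x y)) x z y"

definition contraction :: real where
  "contraction = 1 - 1 / (real shadow_bound)\<^sup>2"

lemma k_pos: "0 < k" using k_large by simp

lemma level_bounds: "n \<le> (level n + 1) * k" "0 < level n \<Longrightarrow> level n * k < n"
proof -
  have "n - 1 < (level n + 1) * k"
    unfolding level_def using k_pos by (metis Suc_eq_plus1 dividend_less_div_times mult.commute mult_Suc)
  then show "n \<le> (level n + 1) * k" by linarith
  have "level n * k \<le> n - 1" unfolding level_def by simp
  moreover assume "0 < level n"
  moreover from this have "n - 1 \<noteq> 0" unfolding level_def by (metis div_0 less_irrefl)
  ultimately show "level n * k < n" by linarith
qed

lemma level_mono: "m \<le> n \<Longrightarrow> level m \<le> level n"
  unfolding level_def by (intro div_le_mono) auto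

lemma contraction_bounds: "0 < contraction" "contraction < 1"
proof -
  have sb: "2 \<le> real shadow_bound" using ball_bound_pos[of "4 * h"] by (simp add: shadow_bound_def)
  then have "(2::real)\<^sup>2 \<le> (real shadow_bound)\<^sup>2" by (intro power_mono) auto
  then have "4 \<le> (real shadow_bound)\<^sup>2" "0 < shadow_bound" using sb by auto
  then have "1 / (real shadow_bound)\<^sup>2 < 1" "0 < 1 / (real shadow_bound)\<^sup>2"
    by simp_all
  then show "0 < contraction" "contraction < 1" by (auto simp: contraction_def)
qed

lemma hit_bounds: "0 \<le> hit j x z y" "hit j x z y \<le> 1"
proof -
  have "0 \<le> hit j x z y \<and> hit j x z y \<le> 1"
    by (induction j arbitrary: y) (auto intro: mean_nonneg mean_le_1)
  then show "0 \<le> hit j x z y" "hit j x z y \<le> 1" by auto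
qed

lemma hit_contraction_step:
  assumes X: "x \<in> X" "y \<in> X" "y' \<in> X" and t: "Suc j * k \<le> d x y" "Suc j * k \<le> d x y'"
    and product: "2 * (Suc j * k) + d y y' \<le> d x y + d x y'"
    and before: "\<And>w w'. \<lbrakk>w \<in> X; w' \<in> X; d x w = Suc j * k; d x w' = Suc j * k; d w w' \<le> 10 * h\<rbrakk>
      \<Longrightarrow> \<bar>hit j x z w - hit j x z w'\<bar> \<le> e"
  shows "\<bar>hit (Suc j) x z y - hit (Suc j) x z y'\<bar> \<le> contraction * e"
proof -
  let ?T = "Suc j * k"
  obtain v where v: "v \<in> shadow x ?T y" "v \<in> shadow x ?T y'"
    using shadows_meet(1)[OF X t product] by blast
  have "\<bar>hit j x z w - hit j x z w'\<bar> \<le> e" if "w \<in> shadow x ?T y" "w' \<in> shadow x ?T y'" for w w'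
    using before shadows_meet(2)[OF X t product that] that by (auto simp: shadow_def)
  from mean_coupling[OF shadow_finite(1)[OF X(1,2) t(1)] shadow_finite(1)[OF X(1,3) t(2)] v
      shadow_finite(2)[OF X(1,2) t(1)] shadow_finite(2)[OF X(1,3) t(2)] this]
  show ?thesis by (simp add: contraction_def)
qed

text \<open>Two descents whose starting points are within \<open>10 * h\<close> stay within \<open>10 * h\<close>, and at each
  jump they merge with a definite probability.\<close>

lemma hit_contraction:
  assumes "x \<in> X" "y \<in> X" "y' \<in> X" "d x y = Suc j * k" "d x y' = Suc j * k" "d y y' \<le> 10 * h"
  shows "\<bar>hit j x z y - hit j x z y'\<bar> \<le> contraction ^ j"
  using assms
proof (induction j arbitrary: y y')
  case 0
  then show ?case by auto
next
  case (Suc j)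
  have "\<bar>hit (Suc j) x z y - hit (Suc j) x z y'\<bar> \<le> contraction * contraction ^ j"
  proof (rule hit_contraction_step)
    show "2 * (Suc j * k) + d y y' \<le> d x y + d x y'"
      using Suc.prems k_large by simp
  qed (use Suc in auto)
  then show ?case by simp
qed

lemma hitting_adjacent_ordered:
  assumes X: "x \<in> X" "a \<in> X" "a' \<in> X" and adj: "d a a' \<le> 1" and ord: "d x a' \<le> d x a"
  shows "\<bar>hitting x z a - hitting x z a'\<bar> \<le> contraction ^ level (d x a')"
proof (cases "level (d x a) = level (d x a')")
  case True
  note same = True
  show ?thesis
  proof (cases "level (d x a')")
    case 0
    then show ?thesis using same hit_bounds[of 0 x z a] hit_bounds[of 0 x z a']
      by (simp add: hitting_def)
  next
    case (Suc j)
    have far: "Suc j * k < d x a" "Suc j * k < d x a'"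
      using level_bounds(2)[of "d x a"] level_bounds(2)[of "d x a'"] same Suc by auto
    have "\<bar>hit (Suc j) x z a - hit (Suc j) x z a'\<bar> \<le> contraction * contraction ^ j"
      by (rule hit_contraction_step[OF X])
        (use far adj in \<open>auto intro: hit_contraction[OF X(1)]\<close>)
    then show ?thesis using same Suc by (simp add: hitting_def)
  qed
next
  case False
  define j where "j = level (d x a')"
  have "d x a \<le> d x a' + d a' a" using dist_triangle X by auto
  then have le: "d x a \<le> d x a' + 1" using adj dist_commute X by auto
  \<comment> \<open>The levels differ only if \<open>a'\<close> lies on a sphere of radius \<open>(j + 1) * k\<close> and \<open>a\<close> just
    outside; then the first jump from \<open>a\<close> leads to the neighbourhood of \<open>a'\<close>.\<close>
  have "j < level (d x a)" using False level_mono[OF ord] by (simp add: j_def)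
  then have "(j + 1) * k \<le> level (d x a) * k" by (intro mult_right_mono) auto
  then have gt: "(j + 1) * k < d x a" using level_bounds(2)[of "d x a"] \<open>j < level (d x a)\<close> by linarith
  then have a': "d x a' = Suc j * k" and a: "d x a = Suc j * k + 1"
    using level_bounds(1)[of "d x a'"] le by (auto simp: j_def)
  have lev: "level (d x a) = Suc j"
  proof -
    have "level (d x a) = Suc j * k div k" unfolding a level_def by simp
    then show ?thesis using k_pos by (metis nonzero_mult_div_cancel_right less_numeral_extra(3))
  qed
  have fin: "finite (shadow x (Suc j * k) a)" "shadow x (Suc j * k) a \<noteq> {}"
    using shadow_finite[OF X(1,2), of "Suc j * k"] a by auto
  have near: "\<bar>hit j x z w - hit j x z a'\<bar> \<le> contraction ^ j" if w: "w \<in> shadow x (Suc j * k) a" for w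
  proof (rule hit_contraction)
    have "d w a' \<le> d w a + d a a'" using dist_triangle X w by (auto simp: shadow_def)
    then show "d w a' \<le> 10 * h" using adj w a h_pos by (auto simp: shadow_def)
  qed (use X w a' in \<open>auto simp: shadow_def\<close>)
  have "hitting x z a = mean (shadow x (Suc j * k) a) (hit j x z)" "hitting x z a' = hit j x z a'"
    by (simp_all add: hitting_def lev flip: j_def)
  then have "hitting x z a - hitting x z a'
      = mean (shadow x (Suc j * k) a) (\<lambda>w. hit j x z w - hit j x z a')"
    using fin by (simp add: mean_def sum_subtractf diff_divide_distrib)
  also have "\<bar>\<dots>\<bar> \<le> contraction ^ j"
  proof -
    have "\<bar>\<Sum>w\<in>shadow x (Suc j * k) a. hit j x z w - hit j x z a'\<bar>
        \<le> card (shadow x (Suc j * k) a) * contraction ^ j"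
      using near by (intro order.trans[OF sum_abs] sum_bounded_above) auto
    then show ?thesis using fin by (simp add: mean_def divide_le_eq card_gt_0_iff mult.commute)
  qed
  finally show ?thesis by (simp add: j_def)
qed

lemma hitting_adjacent:
  assumes X: "x \<in> X" "a \<in> X" "a' \<in> X" and adj: "d a a' \<le> 1"
  shows "\<bar>hitting x z a - hitting x z a'\<bar> \<le> contraction ^ (level (d x a) - 1)"
proof (cases "d x a' \<le> d x a")
  case True
  have "d x a \<le> d x a' + d a' a" using dist_triangle X by auto
  then have "d x a - 1 \<le> d x a' - 1 + 1 * k" using adj dist_commute[OF X(2,3)] k_pos by linarith
  then have "level (d x a) \<le> (d x a' - 1 + 1 * k) div k" unfolding level_def by (rule div_le_mono)
  also have "\<dots> = level (d x a') + 1" using k_pos by (simp add: level_def)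
  finally have "contraction ^ level (d x a') \<le> contraction ^ (level (d x a) - 1)"
    using contraction_bounds by (intro power_decreasing) auto
  with hitting_adjacent_ordered[OF X adj True] show ?thesis by (rule order.trans)
next
  case False
  have "contraction ^ level (d x a) \<le> contraction ^ (level (d x a) - 1)"
    using contraction_bounds by (intro power_decreasing) auto
  then show ?thesis
    using hitting_adjacent_ordered[OF X(1,3,2), of z] adj False dist_commute[OF X(2,3)]
    by (simp add: abs_minus_commute)
qed

lemma hit_support:
  "x \<in> X \<Longrightarrow> y \<in> X \<Longrightarrow> j = 0 \<longrightarrow> d x y \<le> k \<Longrightarrow> hit j x z y \<noteq> 0 \<Longrightarrow> z \<in> vertex_ball x k"
proof (induction j arbitrary: y)
  case 0
  then show ?case by (auto simp: vertex_ball_def)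
next
  case (Suc j)
  from Suc.prems(4) obtain w where w: "w \<in> shadow x (Suc j * k) y" "hit j x z w \<noteq> 0"
    using mean_nonzero by (metis hit.simps(2))
  have "w \<in> X" "j = 0 \<longrightarrow> d x w \<le> k" using w(1) by (auto simp: shadow_def)
  from Suc.IH[OF Suc.prems(1) this w(2)] show ?case .
qed

lemma hitting_support:
  assumes "x \<in> X" "y \<in> X" "hitting x z y \<noteq> 0"
  shows "z \<in> vertex_ball x k"
proof -
  have "level (d x y) = 0 \<longrightarrow> d x y \<le> k" using level_bounds(1)[of "d x y"] by auto
  from hit_support[OF assms(1,2) this assms(3)[unfolded hitting_def]] show ?thesis .
qed

lemma hitting_diff_powr_le:
  fixes p \<theta> :: real
  assumes X: "x \<in> X" "a \<in> X" "a' \<in> X" and adj: "d a a' \<le> 1"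
    and p: "0 \<le> p" and \<theta>: "0 < \<theta>" "\<theta> \<le> 1" "contraction powr p \<le> \<theta> ^ k"
  shows "\<bar>hitting x z a - hitting x z a'\<bar> powr p \<le> \<theta> ^ d x a / \<theta> ^ (2 * k)"
proof -
  define i where "i = level (d x a) - 1"
  have "\<bar>hitting x z a - hitting x z a'\<bar> powr p \<le> (contraction ^ i) powr p"
    using hitting_adjacent[OF X adj] p by (intro powr_mono2) (auto simp: i_def)
  also have "\<dots> = (contraction powr p) ^ i"
    using contraction_bounds by (simp add: powr_realpow[symmetric] powr_powr mult.commute)
  also have "\<dots> \<le> (\<theta> ^ k) ^ i" using \<theta> by (intro power_mono) auto
  also have "\<dots> = \<theta> ^ ((i + 2) * k) / \<theta> ^ (2 * k)"
  proof -
    have "(i + 2) * k = k * i + 2 * k" by simp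
    then show ?thesis using \<theta> by (simp only: power_add power_mult) simp
  qed
  also have "\<dots> \<le> \<theta> ^ d x a / \<theta> ^ (2 * k)"
  proof (intro divide_right_mono power_decreasing)
    have "(level (d x a) + 1) * k \<le> (i + 2) * k" by (intro mult_right_mono) (auto simp: i_def)
    then show "d x a \<le> (i + 2) * k" using level_bounds(1)[of "d x a"] by linarith
  qed (use \<theta> in auto)
  finally show ?thesis .
qed

text \<open>The hypothesis \<open>contraction powr p \<le> \<theta> ^ k\<close> turns the contraction per jump into a decay by
  \<open>\<theta>\<close> per unit of distance, which by \<open>\<theta> * D \<le> 1 / 2\<close> beats the growth of the spheres.\<close>

lemma summable_hitting_adjacent:
  fixes p \<theta> :: real
  assumes X: "a \<in> X" "a' \<in> X" and adj: "d a a' \<le> 1"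
    and p: "0 \<le> p" and \<theta>: "0 < \<theta>" "\<theta> \<le> 1" "contraction powr p \<le> \<theta> ^ k" "\<theta> * D \<le> 1 / 2"
  shows "(\<lambda>(x, z). \<bar>hitting x z a - hitting x z a'\<bar> powr p) summable_on X \<times> X"
proof (rule nonneg_bdd_above_summable_on)
  let ?f = "\<lambda>(x, z). \<bar>hitting x z a - hitting x z a'\<bar> powr p"
  show "bdd_above (sum ?f ` {F. F \<subseteq> X \<times> X \<and> finite F})"
  proof (rule bdd_aboveI2)
    fix F assume "F \<in> {F. F \<subseteq> X \<times> X \<and> finite F}"
    then have F: "F \<subseteq> X \<times> X" "finite F" by auto
    let ?A = "fst ` F"
    have A: "finite ?A" "?A \<subseteq> X" using F by auto
    have finS: "finite (SIGMA x:?A. vertex_ball x k)"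
      using A finite_vertex_ball by (intro finite_SigmaI) auto
    have "sum ?f F = sum ?f {q \<in> F. snd q \<in> vertex_ball (fst q) k}"
    proof (rule sum.mono_neutral_right)
      show "\<forall>q\<in>F - {q \<in> F. snd q \<in> vertex_ball (fst q) k}. ?f q = 0"
      proof
        fix q assume q: "q \<in> F - {q \<in> F. snd q \<in> vertex_ball (fst q) k}"
        then have "fst q \<in> X" "snd q \<notin> vertex_ball (fst q) k" using F by auto
        then have "hitting (fst q) (snd q) a = 0" "hitting (fst q) (snd q) a' = 0"
          using hitting_support X by blast+
        then show "?f q = 0" by (simp add: case_prod_beta)
      qed
    qed (use F in auto)
    also have "\<dots> \<le> sum ?f (SIGMA x:?A. vertex_ball x k)"
      by (rule sum_mono2[OF finS]) force+
    also have "\<dots> = (\<Sum>x\<in>?A. \<Sum>z\<in>vertex_ball x k. \<bar>hitting x z a - hitting x z a'\<bar> powr p)"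
      using A finite_vertex_ball by (subst sum.Sigma) auto
    also have "\<dots> \<le> (\<Sum>x\<in>?A. ball_bound k * (\<theta> ^ d x a / \<theta> ^ (2 * k)))"
    proof (rule sum_mono)
      fix x assume "x \<in> ?A"
      then have x: "x \<in> X" using A by auto
      have "(\<Sum>z\<in>vertex_ball x k. \<bar>hitting x z a - hitting x z a'\<bar> powr p)
          \<le> card (vertex_ball x k) * (\<theta> ^ d x a / \<theta> ^ (2 * k))"
        using hitting_diff_powr_le[OF x X adj p \<theta>(1-3)] by (intro sum_bounded_above) auto
      also have "\<dots> \<le> ball_bound k * (\<theta> ^ d x a / \<theta> ^ (2 * k))"
        using card_vertex_ball[OF x, of k] \<theta> by (intro mult_right_mono) auto
      finally show "(\<Sum>z\<in>vertex_ball x k. \<bar>hitting x z a - hitting x z a'\<bar> powr p)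
          \<le> ball_bound k * (\<theta> ^ d x a / \<theta> ^ (2 * k))" .
    qed
    also have "\<dots> = ball_bound k / \<theta> ^ (2 * k) * (\<Sum>x\<in>?A. \<theta> ^ d x a)"
      by (simp add: sum_distrib_left)
    also have "\<dots> \<le> ball_bound k / \<theta> ^ (2 * k) * 2"
      using sum_exponential_decay[OF \<theta>(1,4) A X(1)] \<theta> by (intro mult_left_mono) auto
    finally show "sum ?f F \<le> ball_bound k / \<theta> ^ (2 * k) * 2" .
  qed
qed auto

lemma summable_hitting:
  fixes p \<theta> :: real
  assumes X: "a \<in> X" "a' \<in> X"
    and p: "0 \<le> p" and \<theta>: "0 < \<theta>" "\<theta> \<le> 1" "contraction powr p \<le> \<theta> ^ k" "\<theta> * D \<le> 1 / 2"
  shows "(\<lambda>(x, z). \<bar>hitting x z a - hitting x z a'\<bar> powr p) summable_on X \<times> X"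
  using X
proof (induction "d a a'" arbitrary: a')
  case 0
  then show ?case using summable_hitting_adjacent[OF _ _ _ p \<theta>] by simp
next
  case (Suc n)
  obtain b where b: "b \<in> X" "d a b = n" "d b a' = d a a' - n"
    using intermediate[OF Suc.prems, of n] Suc.hyps(2) by auto
  let ?f = "\<lambda>(x, z). \<bar>hitting x z a - hitting x z b\<bar> powr p"
    and ?g = "\<lambda>(x, z). \<bar>hitting x z b - hitting x z a'\<bar> powr p"
  have "?f summable_on X \<times> X" using Suc.hyps(1)[OF b(2)[symmetric] Suc.prems(1) b(1)] .
  moreover have "?g summable_on X \<times> X"
    using summable_hitting_adjacent[OF b(1) Suc.prems(2) _ p \<theta>] b Suc.hyps(2) by simp
  ultimately have "(\<lambda>q. 2 powr p * (?f q + ?g q)) summable_on X \<times> X"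
    by (intro summable_on_cmult_right summable_on_add)
  then show ?case
  proof (rule summable_on_comparison_test)
    fix q assume "q \<in> X \<times> X"
    show "(case q of (x, z) \<Rightarrow> \<bar>hitting x z a - hitting x z a'\<bar> powr p) \<le> 2 powr p * (?f q + ?g q)"
      using norm_add_powr_le[OF p, of "hitting (fst q) (snd q) a - hitting (fst q) (snd q) b"
          "hitting (fst q) (snd q) b - hitting (fst q) (snd q) a'"]
      by (simp add: case_prod_beta)
  qed auto
qed

lemma exists_summable_exponent:
  shows "\<exists>p\<ge>2. \<forall>a\<in>X. \<forall>a'\<in>X.
    (\<lambda>(x, z). \<bar>hitting x z a - hitting x z a'\<bar> powr p) summable_on X \<times> X"
proof -
  \<comment> \<open>The denominator \<open>2 * D\<close> would do, but \<open>D\<close> may be \<open>0\<close>.\<close>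
  define \<theta> :: real where "\<theta> = 1 / (2 * (real D + 1))"
  have \<theta>: "0 < \<theta>" "\<theta> \<le> 1" "\<theta> * D \<le> 1 / 2" by (auto simp: \<theta>_def field_simps)
  define p where "p = max 2 (ln (\<theta> ^ k) / ln contraction)"
  have neg: "ln contraction < 0" using contraction_bounds by simp
  have "p * ln contraction \<le> ln (\<theta> ^ k)"
    using neg by (auto simp: p_def max_def field_simps split: if_splits)
  then have "exp (p * ln contraction) \<le> exp (ln (\<theta> ^ k))" by (subst exp_le_cancel_iff)
  then have le: "contraction powr p \<le> \<theta> ^ k"
    using contraction_bounds \<theta> by (simp add: powr_def)
  have p: "2 \<le> p" by (simp add: p_def)
  then have "0 \<le> p" by simp
  from summable_hitting[OF _ _ this \<theta>(1,2) le \<theta>(3)] p show ?thesis by blast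
qed

lemma hit_total:
  assumes "x \<in> X" "y \<in> X" "if j = 0 then d x y \<le> k else j * k \<le> d x y"
  shows "(\<Sum>z\<in>vertex_ball x k. hit j x z y) = 1"
  using assms
proof (induction j arbitrary: y)
  case 0
  then have "y \<in> vertex_ball x k" by (simp add: vertex_ball_def)
  then show ?case using finite_vertex_ball[OF assms(1), of k] by (simp add: of_bool_def)
next
  case (Suc j)
  let ?F = "shadow x (Suc j * k) y"
  have t: "Suc j * k \<le> d x y" using Suc.prems(3) by simp
  have "(\<Sum>z\<in>vertex_ball x k. hit (Suc j) x z y) = mean ?F (\<lambda>w. \<Sum>z\<in>vertex_ball x k. hit j x z w)"
    by (simp only: hit.simps sum_mean)
  also have "\<dots> = mean ?F (\<lambda>w. 1)"
    unfolding mean_def using Suc.IH[OF assms(1)] by (auto simp: shadow_def intro!: sum.cong)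
  also have "\<dots> = 1"
    using shadow_finite[OF assms(1) Suc.prems(2) t] by (simp add: mean_def)
  finally show ?case .
qed

text \<open>A probability measure on at most \<open>ball_bound k\<close> points has an atom of at least the average
  mass.\<close>

lemma hitting_large:
  assumes "x \<in> X" "y \<in> X"
  shows "\<exists>z\<in>vertex_ball x k. 1 / ball_bound k \<le> hitting x z y"
proof (rule ccontr)
  assume "\<not> ?thesis"
  then have less: "\<And>z. z \<in> vertex_ball x k \<Longrightarrow> hitting x z y < 1 / ball_bound k" by force
  have total: "(\<Sum>z\<in>vertex_ball x k. hitting x z y) = 1"
    unfolding hitting_def
    by (rule hit_total[OF assms])
      (use level_bounds(1)[of "d x y"] level_bounds(2)[of "d x y"] in auto)
  then have "vertex_ball x k \<noteq> {}" by auto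
  then have "(\<Sum>z\<in>vertex_ball x k. hitting x z y) < (\<Sum>z\<in>vertex_ball x k. 1 / ball_bound k)"
    using less finite_vertex_ball[OF assms(1)] by (intro sum_strict_mono) auto
  also have "\<dots> \<le> 1" using card_vertex_ball[OF assms(1), of k] ball_bound_pos[of k] by simp
  finally show False using total by simp
qed

text \<open>The descent from \<open>y\<close> follows every geodesic \<open>[x, b]\<close> with \<open>b\<close> close to \<open>y\<close>.  All jumps
  are compared with this one geodesic, along which \<open>b\<close> moves down together with \<open>y\<close>: by
  hyperbolicity, being within \<open>10 * h\<close> of it before a jump is enough for being so afterwards.
  Comparing each jump with a geodesic from its own starting point would let the errors add up.\<close>

lemma hit_tracks_geodesic:
  assumes "x \<in> X" "y \<in> X" "b \<in> X" "v \<in> X"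
    and "if j = 0 then d x y = k \<and> d x b = k \<and> d y b \<le> 10 * h
         else j * k \<le> d x y \<and> j * k \<le> d x b \<and> 2 * (j * k) + d y b \<le> d x y + d x b"
    and "hit j x z y \<noteq> 0" "d x v = k" "d x v + d v b = d x b"
  shows "d z v \<le> 10 * h"
  using assms
proof (induction j arbitrary: y b)
  case 0
  then have "b = v" using dist_eq_0[of v b] by auto
  with 0 show ?case by (auto split: if_splits)
next
  case (Suc j)
  let ?T = "Suc j * k"
  have far: "?T \<le> d x y" "?T \<le> d x b" "2 * ?T + d y b \<le> d x y + d x b"
    using Suc.prems(5) by simp_all
  obtain w where w: "w \<in> shadow x ?T y" "hit j x z w \<noteq> 0"
    using Suc.prems(6) mean_nonzero by (metis hit.simps(2))
  have wX: "w \<in> X" "d x w = ?T" using w(1) by (auto simp: shadow_def)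
  have "j * k \<le> d v b" using Suc.prems(7,8) far by simp
  then obtain b' where b': "b' \<in> X" "d v b' = j * k" "d b' b = d v b - j * k"
    using intermediate[OF Suc.prems(4,3)] by blast
  have "d x b' \<le> d x v + d v b'" "d x b \<le> d x b' + d b' b"
    using dist_triangle[OF Suc.prems(1,4) b'(1)] dist_triangle[OF Suc.prems(1) b'(1) Suc.prems(3)]
    by blast+
  then have "d x b' = k + j * k" and xb': "d x b' + d b' b = d x b"
    using Suc.prems(7,8) b'(2,3) \<open>j * k \<le> d v b\<close> by linarith+
  then have b'T: "d x b' = ?T" by simp
  have "b' \<in> shadow x ?T b" using geodesic_point_in_shadow b'(1) b'T xb' by blast
  then have "d w b' \<le> 10 * h"
    using shadows_meet(2)[OF Suc.prems(1-3) far w(1)] by blast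
  then have close: "if j = 0 then d x w = k \<and> d x b' = k \<and> d w b' \<le> 10 * h
      else j * k \<le> d x w \<and> j * k \<le> d x b' \<and> 2 * (j * k) + d w b' \<le> d x w + d x b'"
    using wX(2) b'T k_large by auto
  have "d x v + d v b' = d x b'" using Suc.prems(7) b'(2) b'T by simp
  from Suc.IH[OF Suc.prems(1) wX(1) b'(1) Suc.prems(4) close w(2) Suc.prems(7) this]
  show ?case .
qed

lemma hitting_tracks_geodesic:
  assumes "x \<in> X" "y \<in> X" "v \<in> X" "k < d x y" "hitting x z y \<noteq> 0"
    "d x v = k" "d x v + d v y = d x y"
  shows "d z v \<le> 10 * h"
proof -
  have "0 < level (d x y)" using level_bounds(1)[of "d x y"] assms(4) by (auto intro: gr0I)
  moreover from this have "level (d x y) * k < d x y" by (rule level_bounds(2))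
  moreover have "d y y = 0" using dist_eq_0 assms by simp
  ultimately show ?thesis
    using hit_tracks_geodesic[OF assms(1,2,2,3) _ assms(5)[unfolded hitting_def] assms(6,7)] by simp
qed

text \<open>From a point \<open>x\<close> well inside a geodesic \<open>[a, a']\<close> the two ends are seen in different
  directions: the descents from \<open>a\<close> and \<open>a'\<close> end near points of the geodesic that are
  \<open>2 * k > 20 * h\<close> apart.\<close>

lemma hitting_separates:
  assumes X: "a \<in> X" "a' \<in> X" "x \<in> X" and x: "d a x + d x a' = d a a'"
    and far: "k < d a x" "k < d x a'"
  shows "\<exists>z\<in>X. 1 / ball_bound k \<le> \<bar>hitting x z a - hitting x z a'\<bar>"
proof -
  note sym = dist_commute
  have far': "k < d x a" using far sym X by simp
  obtain z where z: "z \<in> vertex_ball x k" "1 / ball_bound k \<le> hitting x z a"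
    using hitting_large[OF X(3,1)] by blast
  have zX: "z \<in> X" using z by (simp add: vertex_ball_def)
  have nz: "hitting x z a \<noteq> 0" using z(2) ball_bound_pos[of k]
    by (smt (verit) divide_pos_pos of_nat_0_less_iff less_le_trans zero_less_one)
  obtain v where v: "v \<in> X" "d x v = k" "d v a = d x a - k" using intermediate X far' by (metis less_imp_le)
  obtain v' where v': "v' \<in> X" "d x v' = k" "d v' a' = d x a' - k"
    using intermediate X far(2) by (metis less_imp_le)
  have zv: "d z v \<le> 10 * h"
    by (rule hitting_tracks_geodesic[OF X(3,1) v(1) far' nz v(2)]) (use v far' in auto)
  have "hitting x z a' = 0"
  proof (rule ccontr)
    assume "hitting x z a' \<noteq> 0"
    from hitting_tracks_geodesic[OF X(3,2) v'(1) far(2) this v'(2)]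
    have "d z v' \<le> 10 * h" using v' far by auto
    moreover have "d v v' \<le> d v z + d z v'" "d a a' \<le> d a v + (d v v' + d v' a')"
      using dist_triangle[of a v a'] dist_triangle[of v v' a'] dist_triangle[of v z v'] X v v' zX
      by fastforce+
    ultimately show False
      using zv v v' x far far' k_large sym[of v z] sym[of a v] sym[of a x] X zX by simp
  qed
  then show ?thesis using z zX by (intro bexI[of _ z]) auto
qed

text \<open>Each vertex of a geodesic \<open>[a, a']\<close> at distance more than \<open>k\<close> from both ends contributes
  a definite amount.\<close>

lemma infsum_hitting_lower_bound:
  fixes p :: real
  assumes X: "a \<in> X" "a' \<in> X" and p: "0 \<le> p"
    and sm: "(\<lambda>(x, z). \<bar>hitting x z a - hitting x z a'\<bar> powr p) summable_on X \<times> X"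
  shows "real (d a a' - (2 * k + 1)) * (1 / ball_bound k) powr p
    \<le> (\<Sum>\<^sub>\<infinity>(x, z)\<in>X \<times> X. \<bar>hitting x z a - hitting x z a'\<bar> powr p)"
proof -
  let ?f = "\<lambda>(x, z). \<bar>hitting x z a - hitting x z a'\<bar> powr p"
  let ?I = "{k<..<d a a' - k}"
  have "\<exists>q. \<forall>i\<in>?I. q i \<in> X \<times> X \<and> d a (fst (q i)) = i \<and>
      1 / ball_bound k \<le> \<bar>hitting (fst (q i)) (snd (q i)) a - hitting (fst (q i)) (snd (q i)) a'\<bar>"
  proof (rule bchoice, rule ballI)
    fix i assume i: "i \<in> ?I"
    then have "i \<le> d a a'" "k < d a a' - i" by auto
    then obtain x where x: "x \<in> X" "d a x = i" "d x a' = d a a' - i"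
      using intermediate[OF X] by blast
    with \<open>k < d a a' - i\<close> obtain z where "z \<in> X" "1 / ball_bound k \<le> \<bar>hitting x z a - hitting x z a'\<bar>"
      using hitting_separates[OF X x(1)] i by auto
    with x show "\<exists>q. q \<in> X \<times> X \<and> d a (fst q) = i \<and>
        1 / ball_bound k \<le> \<bar>hitting (fst q) (snd q) a - hitting (fst q) (snd q) a'\<bar>"
      by (intro exI[of _ "(x, z)"]) auto
  qed
  then obtain q where q: "\<And>i. i \<in> ?I \<Longrightarrow> q i \<in> X \<times> X" "\<And>i. i \<in> ?I \<Longrightarrow> d a (fst (q i)) = i"
    "\<And>i. i \<in> ?I \<Longrightarrow>
      1 / ball_bound k \<le> \<bar>hitting (fst (q i)) (snd (q i)) a - hitting (fst (q i)) (snd (q i)) a'\<bar>"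
    by blast
  have inj: "inj_on q ?I" by (rule inj_onI) (metis q(2))
  have "real (d a a' - (2 * k + 1)) * (1 / ball_bound k) powr p
      = (\<Sum>i\<in>?I. (1 / real (ball_bound k)) powr p)" by (simp add: numeral_2_eq_2)
  also have "\<dots> \<le> (\<Sum>i\<in>?I. ?f (q i))"
    by (rule sum_mono) (use q(3) p in \<open>auto simp: case_prod_beta intro!: powr_mono2\<close>)
  also have "\<dots> = sum ?f (q ` ?I)" by (simp add: sum.reindex[OF inj])
  also have "\<dots> \<le> infsum ?f (X \<times> X)"
  proof (rule finite_sum_le_infsum[OF sm])
    show "q ` ?I \<subseteq> X \<times> X" using q(1) by blast
  qed auto
  finally show ?thesis .
qed

lemma hitting_equivariant:
  assumes f: "bij_betw f X X" "\<And>x y. x \<in> X \<Longrightarrow> y \<in> X \<Longrightarrow> d (f x) (f y) = d x y"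
    and X: "x \<in> X" "y \<in> X" "z \<in> X"
  shows "hitting (f x) (f z) (f y) = hitting x z y"
proof -
  have fX: "f x \<in> X" if "x \<in> X" for x using f(1) that by (auto dest: bij_betwE)
  have inj: "inj_on f X" using f(1) by (rule bij_betw_imp_inj_on)
  have "hit j (f x) (f z) (f y) = hit j x z y" if "y \<in> X" for j y
    using that
  proof (induction j arbitrary: y)
    case 0
    then show ?case using inj X by (simp add: inj_on_eq_iff)
  next
    case (Suc j)
    have "shadow (f x) t (f y) = f ` shadow x t y" for t
    proof (intro equalityI subsetI)
      fix w assume w: "w \<in> shadow (f x) t (f y)"
      then have "w \<in> f ` X" using f(1) by (simp add: shadow_def bij_betw_imp_surj_on)
      then obtain v where "v \<in> X" "w = f v" by blast
      then show "w \<in> f ` shadow x t y" using w f(2) X Suc.prems by (auto simp: shadow_def)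
    qed (use f(2) fX X Suc.prems in \<open>auto simp: shadow_def\<close>)
    moreover have "inj_on f (shadow x t y)" for t
      using inj by (rule inj_on_subset) (auto simp: shadow_def)
    ultimately have "hit (Suc j) (f x) (f z) (f y)
        = mean (shadow x (Suc j * k) y) (\<lambda>w. hit j (f x) (f z) (f w))"
      by (simp add: mean_image)
    also have "\<dots> = hit (Suc j) x z y"
      using Suc.IH by (auto simp: mean_def shadow_def intro!: sum.cong arg_cong2[where f="(/)"])
    finally show ?case .
  qed
  then show ?thesis using f(2) X by (simp add: hitting_def)
qed

end

section \<open>Affine isometric actions from equivariant kernels\<close>

lemma group_actionI:
  fixes G (structure)
  assumes G: "group G"
    and maps: "\<And>g x. g \<in> carrier G \<Longrightarrow> x \<in> E \<Longrightarrow> \<phi> g x \<in> E"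
    and ext: "\<And>g. g \<in> carrier G \<Longrightarrow> \<phi> g \<in> extensional E"
    and one: "\<And>x. x \<in> E \<Longrightarrow> \<phi> \<one> x = x"
    and mult: "\<And>g h x. g \<in> carrier G \<Longrightarrow> h \<in> carrier G \<Longrightarrow> x \<in> E \<Longrightarrow> \<phi> (g \<otimes> h) x = \<phi> g (\<phi> h x)"
  shows "group_action G E \<phi>"
proof -
  interpret group G by (rule G)
  have inverse: "\<phi> (inv g) (\<phi> g x) = x" "\<phi> g (\<phi> (inv g) x) = x" if "g \<in> carrier G" "x \<in> E" for g x
    using mult[of "inv g" g x] mult[of g "inv g" x] one that by auto
  have bij: "\<phi> g \<in> Bij E" if "g \<in> carrier G" for g
  proof -
    have "bij_betw (\<phi> g) E E"
      by (rule bij_betw_byWitness[where f' = "\<phi> (inv g)"]) (use inverse maps that in auto)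
    then show ?thesis using ext that by (simp add: Bij_def)
  qed
  have "\<phi> (g \<otimes> h) = compose E (\<phi> g) (\<phi> h)" if "g \<in> carrier G" "h \<in> carrier G" for g h
    by (rule extensionalityI[of _ E]) (use ext mult that in \<open>auto simp: compose_def\<close>)
  then have "\<phi> \<in> hom G (BijGroup E)" using bij by (auto simp: hom_def BijGroup_def)
  then show ?thesis
    using G by (intro group_action.intro group_hom.intro group_hom_axioms.intro group_BijGroup)
qed

lemma lp_space_add:
  assumes p: "0 \<le> p" and "\<xi> \<in> lp_space p I" "\<eta> \<in> lp_space p I"
  shows "(\<lambda>i. \<xi> i + \<eta> i) \<in> lp_space p I"
proof -
  have "(\<lambda>i. 2 powr p * (norm (\<xi> i) powr p + norm (\<eta> i) powr p)) summable_on I"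
    using assms by (intro summable_on_cmult_right summable_on_add) (auto simp: lp_space_def)
  then have "(\<lambda>i. norm (\<xi> i + \<eta> i) powr p) summable_on I"
    by (rule summable_on_comparison_test) (use norm_add_powr_le[OF p] in auto)
  then show ?thesis using assms by (auto simp: lp_space_def)
qed

text \<open>The cocycle of the action is \<open>b g i = c i g - c i 1\<close>, the formal coboundary of the vector
  \<open>i \<mapsto> c i 1\<close>, which itself need not be \<open>p\<close>-summable.\<close>

lemma proper_affine_action_on_lp_nat:
  fixes G :: "('a, 'm) monoid_scheme" (structure) and I :: "nat set"
    and c :: "nat \<Rightarrow> 'a \<Rightarrow> real" and p :: real
  assumes G: "group G" and p: "0 < p"
    and maps: "\<And>g i. g \<in> carrier G \<Longrightarrow> i \<in> I \<Longrightarrow> \<tau> g i \<in> I"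
    and one: "\<And>i. i \<in> I \<Longrightarrow> \<tau> \<one> i = i"
    and mult: "\<And>g h i. g \<in> carrier G \<Longrightarrow> h \<in> carrier G \<Longrightarrow> i \<in> I \<Longrightarrow> \<tau> (g \<otimes> h) i = \<tau> g (\<tau> h i)"
    and equivariant: "\<And>g y i. g \<in> carrier G \<Longrightarrow> y \<in> carrier G \<Longrightarrow> i \<in> I \<Longrightarrow> c (\<tau> g i) (g \<otimes> y) = c i y"
    and summable: "\<And>g. g \<in> carrier G \<Longrightarrow> (\<lambda>i. \<bar>c i g - c i \<one>\<bar> powr p) summable_on I"
    and proper: "filterlim (\<lambda>g. \<Sum>\<^sub>\<infinity>i\<in>I. \<bar>c i g - c i \<one>\<bar> powr p) at_top
      (inf cofinite (principal (carrier G)))"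
  shows "admits_proper_affine_lp_action G p TYPE('k::{real_normed_field,banach})"
proof -
  interpret group G by fact
  have p0: "0 \<le> p" using p by simp
  define X :: "(nat \<Rightarrow> 'k) set" where "X = lp_space p I"
  define \<pi> :: "'a \<Rightarrow> (nat \<Rightarrow> 'k) \<Rightarrow> (nat \<Rightarrow> 'k)"
    where "\<pi> g = (\<lambda>\<xi>\<in>X. \<lambda>i. if i \<in> I then \<xi> (\<tau> (inv g) i) else 0)" for g
  define b :: "'a \<Rightarrow> nat \<Rightarrow> 'k"
    where "b g i = (if i \<in> I then of_real (c i g - c i \<one>) else 0)" for g i
  define \<alpha> where "\<alpha> g = (\<lambda>\<xi>\<in>X. \<lambda>i. \<pi> g \<xi> i + b g i)" for g
  have XD: "\<xi> i = 0" if "\<xi> \<in> X" "i \<notin> I" for \<xi> i using that by (simp add: X_def lp_space_def)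
  have Xsum: "(\<lambda>i. norm (\<xi> i) powr p) summable_on I" if "\<xi> \<in> X" for \<xi>
    using that by (simp add: X_def lp_space_def)
  have Xadd: "(\<lambda>i. \<xi> i + \<eta> i) \<in> X" if "\<xi> \<in> X" "\<eta> \<in> X" for \<xi> \<eta>
    using lp_space_add[OF p0] that by (simp add: X_def)
  have Xscale: "(\<lambda>i. a * \<xi> i) \<in> X" if "\<xi> \<in> X" for a \<xi>
    using summable_on_cmult_right[OF Xsum[OF that], of "norm a powr p"] XD[OF that]
    by (simp add: X_def lp_space_def norm_mult powr_mult)
  have bij: "bij_betw (\<tau> g) I I" if g: "g \<in> carrier G" for g
  proof (rule bij_betw_byWitness[where f' = "\<tau> (inv g)"])
    show "\<forall>i\<in>I. \<tau> (inv g) (\<tau> g i) = i" using mult[of "inv g" g] one g by auto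
    show "\<forall>i\<in>I. \<tau> g (\<tau> (inv g) i) = i" using mult[of g "inv g"] one g by auto
  qed (use maps g in auto)
  have \<pi>_sum: "(\<lambda>i. norm (\<pi> g \<xi> i) powr p) summable_on I"
    and \<pi>_infsum: "(\<Sum>\<^sub>\<infinity>i\<in>I. norm (\<pi> g \<xi> i) powr p) = (\<Sum>\<^sub>\<infinity>i\<in>I. norm (\<xi> i) powr p)"
    if g: "g \<in> carrier G" and \<xi>: "\<xi> \<in> X" for g \<xi>
  proof -
    have eq: "norm (\<pi> g \<xi> i) powr p = norm (\<xi> (\<tau> (inv g) i)) powr p" if "i \<in> I" for i
      using that \<xi> by (simp add: \<pi>_def)
    note bij' = bij[OF inv_closed[OF g]]
    show "(\<lambda>i. norm (\<pi> g \<xi> i) powr p) summable_on I"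
      using summable_on_reindex_bij_betw[OF bij', of "\<lambda>i. norm (\<xi> i) powr p"] Xsum[OF \<xi>]
      by (simp add: eq cong: summable_on_cong)
    show "(\<Sum>\<^sub>\<infinity>i\<in>I. norm (\<pi> g \<xi> i) powr p) = (\<Sum>\<^sub>\<infinity>i\<in>I. norm (\<xi> i) powr p)"
      using infsum_reindex_bij_betw[OF bij', of "\<lambda>i. norm (\<xi> i) powr p"]
      by (simp add: eq cong: infsum_cong)
  qed
  have \<pi>X: "\<pi> g \<xi> \<in> X" if "g \<in> carrier G" "\<xi> \<in> X" for g \<xi>
    using \<pi>_sum[OF that] that by (auto simp: X_def lp_space_def \<pi>_def)
  have b_norm: "norm (b g i) = \<bar>c i g - c i \<one>\<bar>" if "i \<in> I" for g i
    using that by (simp add: b_def del: of_real_diff)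
  have bX: "b g \<in> X" if "g \<in> carrier G" for g
    using summable[OF that] by (simp add: X_def lp_space_def b_norm cong: summable_on_cong)
      (simp add: b_def)
  have \<alpha>X: "\<alpha> g \<xi> \<in> X" if "g \<in> carrier G" "\<xi> \<in> X" for g \<xi>
    using Xadd[OF \<pi>X bX] that by (simp add: \<alpha>_def)
  have \<pi>_one: "\<pi> \<one> \<xi> = \<xi>" if "\<xi> \<in> X" for \<xi>
    using that XD[OF that] one by (auto simp: \<pi>_def fun_eq_iff)
  have \<pi>_mult: "\<pi> (g \<otimes> h) \<xi> = \<pi> g (\<pi> h \<xi>)"
    if gh: "g \<in> carrier G" "h \<in> carrier G" and \<xi>: "\<xi> \<in> X" for g h \<xi>
  proof
    fix i
    have "\<tau> (inv (g \<otimes> h)) i = \<tau> (inv h) (\<tau> (inv g) i)" if "i \<in> I"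
      using mult[of "inv h" "inv g" i] gh that by (simp add: inv_mult_group)
    then show "\<pi> (g \<otimes> h) \<xi> i = \<pi> g (\<pi> h \<xi>) i"
      using \<xi> \<pi>X[OF gh(2) \<xi>] maps[of "inv g" i] gh by (simp add: \<pi>_def)
  qed
  have \<pi>_add: "\<pi> g (\<lambda>i. \<xi> i + \<eta> i) = (\<lambda>i. \<pi> g \<xi> i + \<pi> g \<eta> i)"
    if "\<xi> \<in> X" "\<eta> \<in> X" for g \<xi> \<eta>
    using that Xadd[OF that] by (auto simp: \<pi>_def fun_eq_iff)
  have \<pi>_scale: "\<pi> g (\<lambda>i. a * \<xi> i) = (\<lambda>i. a * \<pi> g \<xi> i)" if "\<xi> \<in> X" for g a \<xi>
    using that Xscale[OF that] by (auto simp: \<pi>_def fun_eq_iff)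
  have cocycle: "b (g \<otimes> h) i = \<pi> g (b h) i + b g i"
    if gh: "g \<in> carrier G" "h \<in> carrier G" for g h i
  proof (cases "i \<in> I")
    case True
    let ?i = "\<tau> (inv g) i"
    have "?i \<in> I" using maps gh True by auto
    moreover have "c i (g \<otimes> h) = c ?i h" "c i g = c ?i \<one>"
      using equivariant[of "inv g" "g \<otimes> h" i] equivariant[of "inv g" g i] gh True
      by (simp_all add: m_assoc[symmetric])
    ultimately show ?thesis using True bX[OF gh(2)] by (simp add: \<pi>_def b_def)
  qed (use bX gh in \<open>simp add: \<pi>_def b_def\<close>)
  have "group_action G X \<pi>"
    by (rule group_actionI[OF G]) (use \<pi>X \<pi>_one \<pi>_mult in \<open>auto simp: \<pi>_def[abs_def]\<close>)
  then have "linear_isometric_action G X (lp_norm p I) \<pi>"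
    unfolding linear_isometric_action_def lp_norm_def using \<pi>_add \<pi>_scale \<pi>_infsum by auto
  moreover have "group_action G X \<alpha>"
  proof (rule group_actionI[OF G])
    show "\<alpha> \<one> \<xi> = \<xi>" if "\<xi> \<in> X" for \<xi>
      using that \<pi>_one[OF that] by (simp add: \<alpha>_def b_def fun_eq_iff)
    show "\<alpha> (g \<otimes> h) \<xi> = \<alpha> g (\<alpha> h \<xi>)"
      if gh: "g \<in> carrier G" "h \<in> carrier G" and \<xi>: "\<xi> \<in> X" for g h \<xi>
      using \<alpha>X[OF gh(2) \<xi>] \<xi> \<pi>_add[OF \<pi>X[OF gh(2) \<xi>] bX[OF gh(2)]]
      by (simp add: \<alpha>_def \<pi>_mult[OF gh \<xi>] cocycle[OF gh] add.assoc)
  qed (use \<alpha>X in \<open>auto simp: \<alpha>_def\<close>)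
  moreover have "\<alpha> g \<xi> = (\<lambda>i. \<pi> g \<xi> i + b g i)" if "\<xi> \<in> X" for g \<xi>
    using that by (simp add: \<alpha>_def)
  ultimately have affine: "affine_isometric_action G X (lp_norm p I) \<alpha>"
    unfolding affine_isometric_action_def using bX by blast
  have "proper_action G X (lp_norm p I) \<alpha>"
    unfolding proper_action_def
  proof (intro ballI, unfold filterlim_at_top, intro allI)
    fix \<xi> and Z :: real
    assume \<xi>: "\<xi> \<in> X"
    \<comment> \<open>Since \<open>b g = \<alpha> g \<xi> - \<pi> g \<xi>\<close> and \<open>\<pi> g \<xi>\<close> has the norm of \<open>\<xi>\<close>, unboundedness of \<open>b\<close> passes
      to the orbit of \<open>\<xi>\<close>.\<close>
    define C where "C = (\<Sum>\<^sub>\<infinity>i\<in>I. norm (\<xi> i) powr p)"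
    have large: "Z \<le> lp_norm p I (\<alpha> g \<xi>)"
      if g: "g \<in> carrier G"
        and big: "2 powr p * (max Z 0 powr p + C) \<le> (\<Sum>\<^sub>\<infinity>i\<in>I. \<bar>c i g - c i \<one>\<bar> powr p)" for g
    proof -
      let ?N = "\<Sum>\<^sub>\<infinity>i\<in>I. norm (\<alpha> g \<xi> i) powr p"
      have b: "b g i = \<alpha> g \<xi> i + - \<pi> g \<xi> i" for i using \<xi> by (simp add: \<alpha>_def)
      have "(\<Sum>\<^sub>\<infinity>i\<in>I. \<bar>c i g - c i \<one>\<bar> powr p) = (\<Sum>\<^sub>\<infinity>i\<in>I. norm (b g i) powr p)"
        by (rule infsum_cong) (simp add: b_norm)
      also have "\<dots> \<le> (\<Sum>\<^sub>\<infinity>i\<in>I. 2 powr p * (norm (\<alpha> g \<xi> i) powr p + norm (\<pi> g \<xi> i) powr p))"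
        using norm_add_powr_le[OF p0, of "\<alpha> g \<xi> _" "- \<pi> g \<xi> _"]
        by (intro infsum_mono Xsum bX g summable_on_cmult_right summable_on_add \<alpha>X \<pi>X \<xi>)
          (simp add: b)
      also have "\<dots> = 2 powr p * (?N + C)"
        using \<pi>_infsum[OF g \<xi>]
        by (simp add: infsum_cmult_right' infsum_add[OF Xsum[OF \<alpha>X[OF g \<xi>]] \<pi>_sum[OF g \<xi>]] C_def)
      finally have "2 powr p * (max Z 0 powr p + C) \<le> 2 powr p * (?N + C)" using big by linarith
      then have "max Z 0 powr p \<le> ?N" by simp
      then have "(max Z 0 powr p) powr (1 / p) \<le> ?N powr (1 / p)"
        using p by (intro powr_mono2) auto
      then show ?thesis using p by (simp add: lp_norm_def powr_powr)
    qed
    have "eventually (\<lambda>g. g \<in> carrier G) (inf cofinite (principal (carrier G)))"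
      by (simp add: eventually_inf_principal)
    moreover have "eventually (\<lambda>g. 2 powr p * (max Z 0 powr p + C)
        \<le> (\<Sum>\<^sub>\<infinity>i\<in>I. \<bar>c i g - c i \<one>\<bar> powr p)) (inf cofinite (principal (carrier G)))"
      using proper unfolding filterlim_at_top by blast
    ultimately show "eventually (\<lambda>g. Z \<le> lp_norm p I (\<alpha> g \<xi>)) (inf cofinite (principal (carrier G)))"
      by eventually_elim (rule large)
  qed
  with affine show ?thesis
    unfolding admits_proper_affine_lp_action_def X_def by blast
qed

text \<open>An enumeration of the countable index set transports the action to a set of natural
  numbers.\<close>

lemma proper_affine_action_on_lp:
  fixes G :: "('a, 'm) monoid_scheme" (structure) and J :: "'j set"
    and c :: "'j \<Rightarrow> 'a \<Rightarrow> real" and p :: real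
  assumes G: "group G" and p: "0 < p" and J: "countable J"
    and maps: "\<And>g i. g \<in> carrier G \<Longrightarrow> i \<in> J \<Longrightarrow> \<tau> g i \<in> J"
    and one: "\<And>i. i \<in> J \<Longrightarrow> \<tau> \<one> i = i"
    and mult: "\<And>g h i. g \<in> carrier G \<Longrightarrow> h \<in> carrier G \<Longrightarrow> i \<in> J \<Longrightarrow> \<tau> (g \<otimes> h) i = \<tau> g (\<tau> h i)"
    and equivariant: "\<And>g y i. g \<in> carrier G \<Longrightarrow> y \<in> carrier G \<Longrightarrow> i \<in> J \<Longrightarrow> c (\<tau> g i) (g \<otimes> y) = c i y"
    and summable: "\<And>g. g \<in> carrier G \<Longrightarrow> (\<lambda>i. \<bar>c i g - c i \<one>\<bar> powr p) summable_on J"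
    and proper: "filterlim (\<lambda>g. \<Sum>\<^sub>\<infinity>i\<in>J. \<bar>c i g - c i \<one>\<bar> powr p) at_top
      (inf cofinite (principal (carrier G)))"
  shows "admits_proper_affine_lp_action G p TYPE('k::{real_normed_field,banach})"
proof -
  let ?enc = "to_nat_on J"
  define dec where "dec = the_inv_into J ?enc"
  have inj: "inj_on ?enc J" by (rule inj_on_to_nat_on[OF J])
  then have bij: "bij_betw ?enc J (?enc ` J)" by (rule inj_on_imp_bij_betw)
  have dec: "dec (?enc i) = i" if "i \<in> J" for i
    unfolding dec_def using inj that by (rule the_inv_into_f_f)
  let ?f = "\<lambda>g i. \<bar>c (dec i) g - c (dec i) \<one>\<bar> powr p"
  have sum: "(?f g) summable_on (?enc ` J)" if "g \<in> carrier G" for g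
    using summable[OF that] summable_on_reindex_bij_betw[OF bij, of "?f g"]
    by (simp add: dec cong: summable_on_cong)
  have infsum: "infsum (?f g) (?enc ` J) = (\<Sum>\<^sub>\<infinity>i\<in>J. \<bar>c i g - c i \<one>\<bar> powr p)" for g
    using infsum_reindex_bij_betw[OF bij, of "?f g"] by (simp add: dec cong: infsum_cong)
  show ?thesis
  proof (rule proper_affine_action_on_lp_nat[OF G p,
        where I = "?enc ` J" and \<tau> = "\<lambda>g i. ?enc (\<tau> g (dec i))" and c = "\<lambda>i. c (dec i)"])
    show "filterlim (\<lambda>g. infsum (?f g) (?enc ` J)) at_top (inf cofinite (principal (carrier G)))"
      unfolding infsum by (rule proper)
  qed (use maps one mult equivariant sum dec in auto)
qed

section \<open>Hyperbolic groups\<close>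

lemma (in finitely_generated_group) word_metric_hyperbolic:
  assumes "fine_triangles G S \<delta>"
  obtains h k where "hyperbolic_graph (carrier G) word_dist (2 * card S) h k"
proof -
  obtain n :: nat where "\<delta> \<le> real n" using real_arch_simple by blast
  define h where "h = n + 1"
  have "\<delta> \<le> real (2 * h)" using \<open>\<delta> \<le> real n\<close> by (simp add: h_def)
  then have thin: "word_dist v w \<le> 2 * h"
    if "x \<in> carrier G" "y \<in> carrier G" "y' \<in> carrier G" "v \<in> carrier G" "w \<in> carrier G"
      "word_dist x v + word_dist v y = word_dist x y" "word_dist x w + word_dist w y' = word_dist x y'"
      "word_dist x v = word_dist x w"
      "2 * word_dist x v + word_dist y y' \<le> word_dist x y + word_dist x y'" for x y y' v w
    using thin_from_fine_triangles[OF assms that] by linarith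
  have "hyperbolic_graph (carrier G) word_dist (2 * card S) h (10 * h + 1)"
  proof
    show "1 \<le> h" "10 * h < 10 * h + 1" by (auto simp: h_def)
  qed (fact word_dist_eq_0_iff word_dist_commute word_dist_triangle word_dist_intermediate
      unit_sphere_bound thin)+
  then show thesis by (rule that)
qed

theorem theorem1p1:
  fixes G :: "('a, 'm) monoid_scheme"
  assumes "hyperbolic_group G"
  shows "\<exists>p::real. 2 \<le> p \<and>
    admits_proper_affine_lp_action G p TYPE('k::{real_normed_field,banach})"
proof -
  from assms obtain S \<delta> where "group G" and S: "finite S" "S \<subseteq> carrier G" "generate G S = carrier G"
    and fine: "fine_triangles G S \<delta>" by (auto simp: hyperbolic_group_def)
  interpret group G by fact
  interpret finitely_generated_group G S by unfold_locales (use S in auto)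
  obtain h k where "hyperbolic_graph (carrier G) word_dist (2 * card S) h k"
    using word_metric_hyperbolic[OF fine] by blast
  then interpret hyperbolic_graph "carrier G" word_dist "2 * card S" h k .
  obtain p :: real where p: "2 \<le> p" and sum: "\<And>a a'. a \<in> carrier G \<Longrightarrow> a' \<in> carrier G \<Longrightarrow>
    (\<lambda>(x, z). \<bar>hitting x z a - hitting x z a'\<bar> powr p) summable_on carrier G \<times> carrier G"
    using exists_summable_exponent by blast
  define \<tau> where "\<tau> g q = (g \<otimes>\<^bsub>G\<^esub> fst q, g \<otimes>\<^bsub>G\<^esub> snd q)" for g and q :: "'a \<times> 'a"
  define c where "c q = hitting (fst q) (snd q)" for q
  let ?J = "carrier G \<times> carrier G"
  let ?B = "\<lambda>g. \<Sum>\<^sub>\<infinity>q\<in>?J. \<bar>c q g - c q \<one>\<^bsub>G\<^esub>\<bar> powr p"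
  have translation: "bij_betw (\<lambda>x. g \<otimes>\<^bsub>G\<^esub> x) (carrier G) (carrier G)" if "g \<in> carrier G" for g
    by (rule bij_betw_byWitness[where f' = "\<lambda>x. inv\<^bsub>G\<^esub> g \<otimes>\<^bsub>G\<^esub> x"])
      (use that in \<open>auto simp: m_assoc[symmetric]\<close>)
  have lower: "real (word_dist g \<one>\<^bsub>G\<^esub> - (2 * k + 1)) * (1 / ball_bound k) powr p \<le> ?B g"
    if "g \<in> carrier G" for g
    using infsum_hitting_lower_bound[OF that one_closed _ sum[OF that one_closed]] p
    by (simp add: c_def case_prod_unfold)
  have proper: "filterlim ?B at_top (inf cofinite (principal (carrier G)))"
    unfolding filterlim_at_top
  proof
    fix Z :: real
    define e where "e = (1 / real (ball_bound k)) powr p"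
    have e: "0 < e" using ball_bound_pos[of k] by (simp add: e_def)
    define r where "r = nat \<lceil>Z / e\<rceil> + (2 * k + 1)"
    have "Z \<le> ?B g" if g: "g \<in> carrier G" "r < word_dist g \<one>\<^bsub>G\<^esub>" for g
    proof -
      have "Z / e \<le> real (word_dist g \<one>\<^bsub>G\<^esub> - (2 * k + 1))"
        using g(2) unfolding r_def by linarith
      then have "Z \<le> real (word_dist g \<one>\<^bsub>G\<^esub> - (2 * k + 1)) * e"
        using e by (simp add: pos_divide_le_eq)
      also have "\<dots> \<le> ?B g" using lower[OF g(1)] by (simp add: e_def)
      finally show ?thesis .
    qed
    then have "{g. \<not> (g \<in> carrier G \<longrightarrow> Z \<le> ?B g)} \<subseteq> vertex_ball \<one>\<^bsub>G\<^esub> r"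
      using dist_commute by (fastforce simp: vertex_ball_def)
    then have "finite {g. \<not> (g \<in> carrier G \<longrightarrow> Z \<le> ?B g)}"
      using finite_vertex_ball[OF one_closed] finite_subset by blast
    then show "eventually (\<lambda>g. Z \<le> ?B g) (inf cofinite (principal (carrier G)))"
      by (simp add: eventually_inf_principal eventually_cofinite)
  qed
  have "admits_proper_affine_lp_action G p TYPE('k)"
  proof (rule proper_affine_action_on_lp[where J = ?J and \<tau> = \<tau> and c = c])
    show "countable ?J" using countable_vertices by auto
    show "c (\<tau> g q) (g \<otimes>\<^bsub>G\<^esub> y) = c q y" if "g \<in> carrier G" "y \<in> carrier G" "q \<in> ?J" for g y q
      unfolding c_def \<tau>_def fst_conv snd_conv
      by (rule hitting_equivariant[OF translation[OF that(1)]])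
        (use that word_dist_translate in auto)
    show "(\<lambda>q. \<bar>c q g - c q \<one>\<^bsub>G\<^esub>\<bar> powr p) summable_on ?J" if "g \<in> carrier G" for g
      using sum[OF that one_closed] by (simp add: c_def case_prod_unfold)
  qed (use p proper \<open>group G\<close> in \<open>auto simp: \<tau>_def m_assoc\<close>)
  with p show ?thesis by blast
qed

end
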